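(* Let $k$ be a field of characteristic $0$ and let $\varphi\in k\langle\langle X,Y\rangle\rangle$ be a commutator Lie-like element with $c_2(\varphi)=0$. Suppose that $\varphi$ satisfies the 5-cycle relation $$\varphi(X_{12},X_{23})+\varphi(X_{34},X_{45})+\varphi(X_{51},X_{12})+\varphi(X_{23},X_{34})+\varphi(X_{45},X_{51})=0$$ in $\hat{\mathfrak P}_5$. Then it also satisfies the 3- and 2-cycle relations $$\varphi(X,Y)+\varphi(Y,Z)+\varphi(Z,X)=0\quad\text{with } X+Y+Z=0,$$ $$\varphi(X,Y)+\varphi(Y,X)=0.$$
   Context: $k\langle\langle X,Y\rangle\rangle$ is the non-commutative formal power series ring in two variables, with continuous coproduct $\Delta$ determined by $\Delta(X)=X\otimes1+1\otimes X$, $\Delta(Y)=Y\otimes1+1\otimes Y$. An element $\varphi$ is Lie-like if $\Delta(\varphi)=\varphi\otimes1+1\otimes\varphi$; the set of Lie-like elements is the completed free Lie algebra $\mathfrak F_2$ on $X,Y$. $\varphi$ is commutator Lie-like if it is Lie-like and its coefficients of $X$ and of $Y$ are both $0$ (i.e. $\varphi\in[\mathfrak F_2,\mathfrak F_2]$). $c_2(\varphi)$ is the coefficient of $XY$ in $\varphi$. $\hat{\mathfrak P}_5$ is the completion, with respect to the natural grading (each $X_{ij}$ in degree $1$), of the Lie algebra $\mathfrak P_5$ over $k$ generated by $X_{ij}$ ($1\le i,j\le5$) with relations $X_{ii}=0$, $X_{ij}=X_{ji}$, $\sum_{j=1}^5X_{ij}=0$ for $1\le i\le5$, and $[X_{ij},X_{kl}]=0$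 if $\{i,j\}\cap\{k,l\}=\emptyset$. $\varphi(a,b)$ denotes the image of $\varphi$ under the continuous homomorphism $X\mapsto a$, $Y\mapsto b$. *)

theory Defs
  imports Main "HOL-Library.Numeral_Type"
begin

section \<open>Non-commutative formal power series\<close>

typedef ('a, 'k) ncfps = "UNIV :: ('a list \<Rightarrow> 'k) set"
  morphisms nc_coeff Abs_ncfps
  by simp

lemma nc_coeff_Abs [simp]: "nc_coeff (Abs_ncfps f) w = f w"
  by (simp add: Abs_ncfps_inverse)

lemma ncfps_eqI: "(\<And>w. nc_coeff f w = nc_coeff g w) \<Longrightarrow> f = g"
  by (metis nc_coeff_inject ext)

text \<open>The coefficient ring need not be commutative, but it commutes with the letters.\<close>

instantiation ncfps :: (type, ring_1) ring_1
begin

definition "0 = Abs_ncfps (\<lambda>_. 0)"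
definition "1 = Abs_ncfps (\<lambda>w. if w = [] then 1 else 0)"
definition "f + g = Abs_ncfps (\<lambda>w. nc_coeff f w + nc_coeff g w)"
definition "f - g = Abs_ncfps (\<lambda>w. nc_coeff f w - nc_coeff g w)"
definition "- f = Abs_ncfps (\<lambda>w. - nc_coeff f w)"
definition "f * g =
  Abs_ncfps (\<lambda>w. \<Sum>i\<le>length w. nc_coeff f (take i w) * nc_coeff g (drop i w))"

instance
proof
  fix f g h :: "('a, 'b) ncfps"
  show "f * g * h = f * (g * h)"
  proof (rule ncfps_eqI)
    fix w :: "'a list"
    let ?t = "\<lambda>i j. nc_coeff f (take i w) * nc_coeff g (take j (drop i w))
                 * nc_coeff h (drop (i + j) w)"
    have "nc_coeff (f * g * h) w = (\<Sum>m\<le>length w. \<Sum>i\<le>m. ?t i (m - i))"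
      by (auto simp: times_ncfps_def sum_distrib_right min_absorb1 min_absorb2 drop_take
          intro!: sum.cong)
    also have "\<dots> = (\<Sum>(i, j) | i + j \<le> length w. ?t i j)"
      by (rule sum.triangle_reindex_eq [symmetric])
    also have "\<dots> = (\<Sum>(i, j)\<in>(SIGMA i:{..length w}. {..length w - i}). ?t i j)"
      by (rule sum.cong) auto
    also have "\<dots> = (\<Sum>i\<le>length w. \<Sum>j\<le>length w - i. ?t i j)"
      by (rule sum.Sigma [symmetric]) auto
    also have "\<dots> = nc_coeff (f * (g * h)) w"
      by (auto simp: times_ncfps_def sum_distrib_left mult.assoc add.commute intro!: sum.cong)
    finally show "nc_coeff (f * g * h) w = nc_coeff (f * (g * h)) w" .
  qed
  show "1 * f = f"
  proof (rule ncfps_eqI)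
    fix w :: "'a list"
    have "nc_coeff (1 * f) w =
      (\<Sum>i\<le>length w. if i = 0 then nc_coeff f w else 0)"
      unfolding times_ncfps_def one_ncfps_def nc_coeff_Abs by (rule sum.cong) auto
    then show "nc_coeff (1 * f) w = nc_coeff f w" by simp
  qed
  show "f * 1 = f"
  proof (rule ncfps_eqI)
    fix w :: "'a list"
    have "nc_coeff (f * 1) w =
      (\<Sum>i\<le>length w. if i = length w then nc_coeff f w else 0)"
      unfolding times_ncfps_def one_ncfps_def nc_coeff_Abs by (rule sum.cong) auto
    then show "nc_coeff (f * 1) w = nc_coeff f w" by simp
  qed
  show "(f + g) * h = f * h + g * h" "f * (g + h) = f * g + f * h"
    by (auto intro!: ncfps_eqI
        simp: times_ncfps_def plus_ncfps_def distrib_left distrib_right sum.distrib)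
  show "(0 :: ('a, 'b) ncfps) \<noteq> 1"
  proof
    assume "(0 :: ('a, 'b) ncfps) = 1"
    then have "nc_coeff (0 :: ('a, 'b) ncfps) [] = nc_coeff 1 []" by simp
    then show False by (simp add: zero_ncfps_def one_ncfps_def)
  qed
qed (auto intro!: ncfps_eqI
      simp: plus_ncfps_def minus_ncfps_def uminus_ncfps_def zero_ncfps_def algebra_simps)

end

definition nc_var :: "'a \<Rightarrow> ('a, 'k::ring_1) ncfps" where
  "nc_var x = Abs_ncfps (\<lambda>w. if w = [x] then 1 else 0)"

definition nc_scale :: "'k \<Rightarrow> ('a, 'k::ring_1) ncfps \<Rightarrow> ('a, 'k) ncfps" where
  "nc_scale c f = Abs_ncfps (\<lambda>w. c * nc_coeff f w)"

definition nc_hpart :: "nat \<Rightarrow> ('a, 'k::ring_1) ncfps \<Rightarrow> ('a, 'k) ncfps" where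
  "nc_hpart n f = Abs_ncfps (\<lambda>w. if length w = n then nc_coeff f w else 0)"

definition nc_bracket ::
  "('a, 'k::ring_1) ncfps \<Rightarrow> ('a, 'k) ncfps \<Rightarrow> ('a, 'k) ncfps" where
  "nc_bracket f g = f * g - g * f"

text \<open>
  The image of \<open>f\<close> under the continuous algebra homomorphism sending each letter \<open>x\<close> to
  \<open>s x\<close>. It is meaningful when every \<open>s x\<close> has zero constant term: then a product of more
  than \<open>length w\<close> of them does not contribute to the coefficient of \<open>w\<close>, so that the sum below
  is the full sum over all words \<open>u\<close>.
\<close>
definition nc_subst ::
  "('x::finite \<Rightarrow> ('a, 'k::field) ncfps) \<Rightarrow> ('x, 'k) ncfps \<Rightarrow> ('a, 'k) ncfps" where
  "nc_subst s f = Abs_ncfps (\<lambda>w. \<Sum>u | length u \<le> length w.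
     nc_coeff f u * nc_coeff (prod_list (map s u)) w)"


section \<open>Coproduct and Lie-like series\<close>

text \<open>
  The completed tensor square is represented by series whose coefficients are again series: the
  coefficient of \<open>u \<otimes> v\<close> in \<open>F\<close> is \<open>nc_coeff (nc_coeff F u) v\<close>. As coefficients commute with
  letters, the product of this iterated ring satisfies
  \<open>(f \<otimes> g) (f' \<otimes> g') = f f' \<otimes> g g'\<close>.
\<close>
type_synonym ('a, 'k) ncfps2 = "('a, ('a, 'k) ncfps) ncfps"

definition nc_tensor ::
  "('a, 'k::field) ncfps \<Rightarrow> ('a, 'k) ncfps \<Rightarrow> ('a, 'k) ncfps2" where
  "nc_tensor f g = Abs_ncfps (\<lambda>u. nc_scale (nc_coeff f u) g)"

lemma nc_coeff_sum: "nc_coeff (sum f A) w = (\<Sum>x\<in>A. nc_coeff (f x) w)"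
  by (induction A rule: infinite_finite_induct) (auto simp: zero_ncfps_def plus_ncfps_def)

lemma nc_tensor_mult: "nc_tensor f g * nc_tensor f' g' = nc_tensor (f * f') (g * g')"
  by (intro ncfps_eqI)
     (simp add: nc_tensor_def times_ncfps_def nc_coeff_sum nc_scale_def sum_product mult_ac)

text \<open>
  The continuous algebra homomorphism with \<open>x \<mapsto> x \<otimes> 1 + 1 \<otimes> x\<close> on letters. The image of a word
  \<open>w\<close> is homogeneous of total degree \<open>length w\<close>, so longer words do not contribute to the
  coefficient of \<open>u \<otimes> v\<close>.
\<close>
definition nc_coprod :: "('a::finite, 'k::field) ncfps \<Rightarrow> ('a, 'k) ncfps2" where
  "nc_coprod f = Abs_ncfps (\<lambda>u. Abs_ncfps (\<lambda>v.
     \<Sum>w | length w \<le> length u + length v. nc_coeff f w *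
       nc_coeff (nc_coeff (prod_list
         (map (\<lambda>x. nc_tensor (nc_var x) 1 + nc_tensor 1 (nc_var x)) w)) u) v))"

definition lie_like :: "('a::finite, 'k::field) ncfps \<Rightarrow> bool" where
  "lie_like f \<longleftrightarrow> nc_coprod f = nc_tensor f 1 + nc_tensor 1 f"


section \<open>Series in two variables\<close>

datatype letter = LX | LY

lemma UNIV_letter: "UNIV = {LX, LY}"
  using letter.exhaust by auto

instance letter :: finite
  by standard (simp add: UNIV_letter)

abbreviation nc_X :: "(letter, 'k::field) ncfps" where "nc_X \<equiv> nc_var LX"
abbreviation nc_Y :: "(letter, 'k::field) ncfps" where "nc_Y \<equiv> nc_var LY"

definition commutator_lie_like :: "(letter, 'k::field) ncfps \<Rightarrow> bool" where
  "commutator_lie_like f \<longleftrightarrow> lie_like f \<and> nc_coeff f [LX] = 0 \<and> nc_coeff f [LY] = 0"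

definition c2 :: "(letter, 'k) ncfps \<Rightarrow> 'k" where
  "c2 f = nc_coeff f [LX, LY]"

definition nc_at ::
  "(letter, 'k::field) ncfps \<Rightarrow> ('a, 'k) ncfps \<Rightarrow> ('a, 'k) ncfps \<Rightarrow> ('a, 'k) ncfps" where
  "nc_at f a b = nc_subst (case_letter a b) f"


section \<open>Lie algebras by generators and relations\<close>

text \<open>The free Lie algebra, as the Lie subalgebra generated by the letters.\<close>
inductive_set free_lie :: "('a, 'k::field) ncfps set" where
  zero: "0 \<in> free_lie"
| var: "nc_var x \<in> free_lie"
| add: "f \<in> free_lie \<Longrightarrow> g \<in> free_lie \<Longrightarrow> f + g \<in> free_lie"
| scale: "f \<in> free_lie \<Longrightarrow> nc_scale c f \<in> free_lie"
| bracket: "f \<in> free_lie \<Longrightarrow> g \<in> free_lie \<Longrightarrow> nc_bracket f g \<in> free_lie"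

text \<open>The Lie ideal of the free Lie algebra generated by a subset \<open>R\<close> of it.\<close>
inductive_set lie_ideal :: "('a, 'k::field) ncfps set \<Rightarrow> ('a, 'k) ncfps set"
  for R where
  zero: "0 \<in> lie_ideal R"
| rel: "r \<in> R \<Longrightarrow> r \<in> lie_ideal R"
| add: "f \<in> lie_ideal R \<Longrightarrow> g \<in> lie_ideal R \<Longrightarrow> f + g \<in> lie_ideal R"
| scale: "f \<in> lie_ideal R \<Longrightarrow> nc_scale c f \<in> lie_ideal R"
| bracket: "f \<in> free_lie \<Longrightarrow> g \<in> lie_ideal R \<Longrightarrow> nc_bracket f g \<in> lie_ideal R"

text \<open>
  The indices \<open>1, \<dots>, 5\<close> are the elements of the numeral type \<open>5\<close>, in which \<open>5 = 0\<close>.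
\<close>
definition P5_X :: "5 \<Rightarrow> 5 \<Rightarrow> (5 \<times> 5, 'k::field) ncfps" where
  "P5_X i j = nc_var (i, j)"

definition P5_rels :: "(5 \<times> 5, 'k::field) ncfps set" where
  "P5_rels =
     {P5_X i i | i. True} \<union>
     {P5_X i j - P5_X j i | i j. True} \<union>
     {(\<Sum>j\<in>UNIV. P5_X i j) | i. True} \<union>
     {nc_bracket (P5_X i j) (P5_X k l) | i j k l. {i, j} \<inter> {k, l} = {}}"

text \<open>
  The Lie algebra on the generators \<open>P5_X i j\<close> with relations \<open>P5_rels\<close> is
  \<open>free_lie / lie_ideal P5_rels\<close>, graded since the relations are homogeneous. Its completion is
  the product of its graded pieces; its elements are represented by the series all of whose
  homogeneous parts lie in \<open>free_lie\<close>, and two of these represent the same element iff they agree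
  modulo the ideal in every degree.
\<close>
definition P5_hat_eq ::
  "(5 \<times> 5, 'k::field) ncfps \<Rightarrow> (5 \<times> 5, 'k) ncfps \<Rightarrow> bool" where
  "P5_hat_eq f g \<longleftrightarrow> (\<forall>n. nc_hpart n (f - g) \<in> lie_ideal P5_rels)"

end

theory Submission imports Defs "HOL.Vector_Spaces" begin

text \<open>
  The homogeneous parts of a series can be evaluated in any associative algebra, so the pentagon may
  be tested on every system \<open>t\<^sub>i\<^sub>j\<close> satisfying the relations of \<open>P5\<close>. The system with
  \<open>t\<^sub>i\<^sub>5 = 0\<close> and \<open>t\<^sub>1\<^sub>2 = t\<^sub>3\<^sub>4 = X\<close>, \<open>t\<^sub>2\<^sub>3 = t\<^sub>1\<^sub>4 = Y\<close> gives the 2-cycle relation.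

  Let \<open>R(a, b)\<close> be the left-hand side of the 3-cycle relation. Since a Lie-like series is additive on
  mutually commuting pairs of arguments, a signed sum of pentagons over permutations of the indices
  becomes \<open>R(t\<^sub>p\<^sub>q, t\<^sub>q\<^sub>a) + R(t\<^sub>p\<^sub>q, t\<^sub>q\<^sub>b) + R(t\<^sub>p\<^sub>q, t\<^sub>q\<^sub>c) = 0\<close>, that is,
  \<open>R(A, B) + R(A, C) = R(A, B + C)\<close> for \<open>A = t\<^sub>p\<^sub>q\<close>, \<open>B = t\<^sub>q\<^sub>a\<close>, \<open>C = t\<^sub>q\<^sub>b\<close>. These three generate a
  free Lie ideal of \<open>P5\<close>; its adjoint representation on series in \<open>A, B, C\<close>, with the other
  generators acting by derivations, shows that the identity holds for free variables. So \<open>R\<close> has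
  degree at most one in its second argument and, being antisymmetric, in the first; what remains are
  the coefficients in degree two, which vanish with \<open>c2\<close>.
\<close>

section \<open>Coefficients of series and sums over words\<close>

lemma nc_coeff_simps [simp]:
  "nc_coeff 0 w = 0"
  "nc_coeff (f + g) w = nc_coeff f w + nc_coeff g w"
  "nc_coeff (f - g) w = nc_coeff f w - nc_coeff g w"
  "nc_coeff (- f) w = - nc_coeff f w"
  "nc_coeff (nc_scale c f) w = c * nc_coeff f w"
  by (auto simp: zero_ncfps_def plus_ncfps_def minus_ncfps_def uminus_ncfps_def nc_scale_def)

lemma nc_coeff_one: "nc_coeff 1 w = (if w = [] then 1 else 0)"
  by (simp add: one_ncfps_def)

lemma nc_coeff_var: "nc_coeff (nc_var x) w = (if w = [x] then 1 else 0)"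
  by (simp add: nc_var_def)

lemma nc_coeff_times:
  "nc_coeff (f * g) w = (\<Sum>i\<le>length w. nc_coeff f (take i w) * nc_coeff g (drop i w))"
  by (simp add: times_ncfps_def)

lemma nc_coeff_times_Nil [simp]: "nc_coeff (f * g) [] = nc_coeff f [] * nc_coeff g []"
  by (simp add: nc_coeff_times)

lemma nc_coeff_times_Cons:
  "nc_coeff (f * g) (b # w) = nc_coeff f [] * nc_coeff g (b # w) +
     nc_coeff (Abs_ncfps (\<lambda>w. nc_coeff f (b # w)) * g) w"
  by (simp add: nc_coeff_times sum.atMost_Suc_shift del: sum.atMost_Suc)

lemma nc_coeff_var_times:
  "nc_coeff (nc_var x * f) w = (case w of [] \<Rightarrow> 0 | y # v \<Rightarrow> if y = x then nc_coeff f v else 0)"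
proof (cases w)
  case (Cons y v)
  have *: "Abs_ncfps (\<lambda>v. nc_coeff (nc_var x) (y # v)) = (if y = x then 1 else 0)"
    by (intro ncfps_eqI) (simp add: nc_coeff_var nc_coeff_one)
  then show ?thesis
    using Cons by (simp add: nc_coeff_times_Cons *) (simp add: nc_coeff_var)
qed (simp add: nc_coeff_var)

lemma finite_words [simp, intro]: "finite {u :: 'x::finite list. length u = n}"
  using finite_lists_length_eq[of "UNIV :: 'x set" n] by simp

lemma finite_words_le [simp, intro]: "finite {u :: 'x::finite list. length u \<le> n}"
  using finite_lists_length_le[of "UNIV :: 'x set" n] by simp

lemma words_0: "{u :: 'x list. length u = 0} = {[]}"
  by auto

lemma sum_words_Suc:
  "(\<Sum>u | length u = Suc n. g u) = (\<Sum>x\<in>UNIV. \<Sum>u | length u = n. g (x # u))"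
  for g :: "'x::finite list \<Rightarrow> 'b::comm_monoid_add"
proof -
  have "(\<Sum>u | length u = Suc n. g u)
      = (\<Sum>p\<in>(UNIV :: 'x set) \<times> {u. length u = n}. g (fst p # snd p))"
    by (rule sum.reindex_bij_witness[where i = "\<lambda>p. fst p # snd p" and j = "\<lambda>u. (hd u, tl u)"])
       (auto simp: length_Suc_conv)
  also have "\<dots> = (\<Sum>x\<in>UNIV. \<Sum>u | length u = n. g (x # u))"
    by (simp add: sum.cartesian_product case_prod_beta)
  finally show ?thesis .
qed

lemma sum_words_append:
  "(\<Sum>w | length w = m + n. g w) =
     (\<Sum>u | length u = m. \<Sum>v | length v = n. g (u @ v))"
  for g :: "'x::finite list \<Rightarrow> 'b::comm_monoid_add"
  by (induction m arbitrary: g) (auto simp: words_0 sum_words_Suc)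


section \<open>Evaluation of series in associative algebras\<close>

locale assoc_algebra = vector_space sc
  for sc :: "'k::field_char_0 \<Rightarrow> 'r::ring_1 \<Rightarrow> 'r" +
  assumes mult_scale_left [simp]: "sc c a * b = sc c (a * b)"
    and mult_scale_right [simp]: "a * sc c b = sc c (a * b)"
begin

text \<open>One degree is evaluated at a time: the sum is then finite, so the target algebra needs
  no topology.\<close>

definition hev :: "nat \<Rightarrow> ('x::finite, 'k) ncfps \<Rightarrow> ('x \<Rightarrow> 'r) \<Rightarrow> 'r" where
  "hev n f s = (\<Sum>u | length u = n. sc (nc_coeff f u) (prod_list (map s u)))"

lemma hev_linear [simp]:
  "hev n 0 s = 0"
  "hev n (f + g) s = hev n f s + hev n g s"
  "hev n (f - g) s = hev n f s - hev n g s"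
  "hev n (- f) s = - hev n f s"
  "hev n (nc_scale c f) s = sc c (hev n f s)"
  by (simp_all add: hev_def scale_left_distrib scale_left_diff_distrib sum.distrib
      sum_subtractf sum_negf scale_sum_right)

lemma hev_sum: "hev n (sum f A) s = (\<Sum>a\<in>A. hev n (f a) s)"
  by (induction A rule: infinite_finite_induct) auto

lemma hev_hpart: "hev n (nc_hpart m f) s = (if m = n then hev n f s else 0)"
  by (auto simp: hev_def nc_hpart_def intro!: sum.neutral)

lemma hev_var: "hev n (nc_var x) s = (if n = 1 then s x else 0)"
proof -
  have "hev n (nc_var x) s =
      (\<Sum>u | length u = n. if u = [x] then prod_list (map s u) else 0)"
    unfolding hev_def by (intro sum.cong) (auto simp: nc_coeff_var)
  then show ?thesis
    by (auto simp: sum.delta)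
qed

lemma hev_one: "hev n 1 s = (if n = 0 then 1 else 0)"
proof -
  have "hev n 1 s = (\<Sum>u | length u = n. if u = [] then prod_list (map s u) else 0)"
    unfolding hev_def by (intro sum.cong) (auto simp: nc_coeff_one)
  then show ?thesis
    by (auto simp: sum.delta)
qed

lemma hev_mult: "hev n (f * g) s = (\<Sum>i\<le>n. hev i f s * hev (n - i) g s)"
proof -
  let ?p = "\<lambda>u. prod_list (map s u)"
  have "hev n (f * g) s = (\<Sum>w | length w = n. \<Sum>i\<le>n.
      sc (nc_coeff f (take i w) * nc_coeff g (drop i w)) (?p w))"
    unfolding hev_def by (intro sum.cong) (auto simp: nc_coeff_times scale_sum_left)
  also have "\<dots> = (\<Sum>i\<le>n. \<Sum>w | length w = n.
      sc (nc_coeff f (take i w) * nc_coeff g (drop i w)) (?p w))"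
    by (rule sum.swap)
  also have "\<dots> = (\<Sum>i\<le>n. hev i f s * hev (n - i) g s)"
  proof (rule sum.cong)
    fix i assume "i \<in> {..n}"
    then have n: "n = i + (n - i)" by simp
    have "(\<Sum>w | length w = n. sc (nc_coeff f (take i w) * nc_coeff g (drop i w)) (?p w)) =
       (\<Sum>u | length u = i. \<Sum>v | length v = n - i. sc (nc_coeff f u * nc_coeff g v) (?p u * ?p v))"
      by (subst n, subst sum_words_append) (auto intro!: sum.cong)
    also have "\<dots> = hev i f s * hev (n - i) g s"
      by (simp add: hev_def sum_product mult.commute)
    finally show "(\<Sum>w | length w = n.
        sc (nc_coeff f (take i w) * nc_coeff g (drop i w)) (?p w)) = hev i f s * hev (n - i) g s" .
  qed simp
  finally show ?thesis .
qed

end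

definition nc_linear :: "('a, 'k::ring_1) ncfps \<Rightarrow> bool" where
  "nc_linear f \<longleftrightarrow> (\<forall>w. length w \<noteq> 1 \<longrightarrow> nc_coeff f w = 0)"

lemma nc_linear_intros [simp, intro]:
  "nc_linear 0"
  "nc_linear (nc_var x)"
  "nc_linear f \<Longrightarrow> nc_linear g \<Longrightarrow> nc_linear (f + g)"
  "nc_linear f \<Longrightarrow> nc_linear g \<Longrightarrow> nc_linear (f - g)"
  "nc_linear f \<Longrightarrow> nc_linear (- f)"
  by (auto simp: nc_linear_def nc_coeff_var)

context assoc_algebra
begin

lemma hev_linear_neq_1: "nc_linear f \<Longrightarrow> n \<noteq> 1 \<Longrightarrow> hev n f s = 0"
  by (simp add: hev_def nc_linear_def)

lemma hev_prod_list_linear: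
  assumes "\<And>x. nc_linear (s x)"
  shows "hev n (prod_list (map s u)) t =
    (if n = length u then prod_list (map (\<lambda>x. hev 1 (s x) t) u) else 0)"
proof (induction u arbitrary: n)
  case (Cons x u)
  have "hev n (prod_list (map s (x # u))) t =
      (\<Sum>i\<le>n. if i = 1 then hev 1 (s x) t * hev (n - 1) (prod_list (map s u)) t else 0)"
    unfolding list.map prod_list.Cons hev_mult
    by (rule sum.cong) (auto simp: assms hev_linear_neq_1)
  also have "\<dots> = (if n = length (x # u) then prod_list (map (\<lambda>x. hev 1 (s x) t) (x # u)) else 0)"
    by (auto simp: Cons.IH)
  finally show ?case .
qed (simp add: hev_one)

text \<open>Linear substitutions preserve degree: in degree \<open>n\<close> only words of length
  \<open>n\<close> contribute, so the truncation in \<open>nc_subst\<close> loses nothing.\<close>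

lemma hev_subst:
  assumes "\<And>x. nc_linear (s x)"
  shows "hev n (nc_subst s f) t = hev n f (\<lambda>x. hev 1 (s x) t)"
proof -
  have "hev n (nc_subst s f) t = (\<Sum>w | length w = n. \<Sum>u | length u \<le> n.
      sc (nc_coeff f u) (sc (nc_coeff (prod_list (map s u)) w) (prod_list (map t w))))"
    unfolding hev_def by (intro sum.cong) (auto simp: nc_subst_def scale_sum_left)
  also have "\<dots> = (\<Sum>u | length u \<le> n. sc (nc_coeff f u) (hev n (prod_list (map s u)) t))"
    by (subst sum.swap) (simp add: hev_def scale_sum_right)
  also have "\<dots> = hev n f (\<lambda>x. hev 1 (s x) t)"
    unfolding hev_def[of n f]
    by (rule sum.mono_neutral_cong_right) (auto simp: hev_prod_list_linear assms)
  finally show ?thesis .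
qed

lemma hev_at:
  assumes "nc_linear a" "nc_linear b"
  shows "hev n (nc_at f a b) t = hev n f (case_letter (hev 1 a t) (hev 1 b t))"
proof -
  have "(\<lambda>x. hev 1 (case x of LX \<Rightarrow> a | LY \<Rightarrow> b) t) = case_letter (hev 1 a t) (hev 1 b t)"
    by (auto split: letter.split)
  moreover have "nc_linear (case x of LX \<Rightarrow> a | LY \<Rightarrow> b)" for x
    using assms by (auto split: letter.split)
  ultimately show ?thesis
    by (simp add: nc_at_def hev_subst)
qed

end

interpretation nc: assoc_algebra nc_scale
  by standard (auto intro!: ncfps_eqI simp: algebra_simps nc_coeff_times sum_distrib_left)

text \<open>A letter \<open>y\<close> occurs in at most one of the forms \<open>s x\<close>, namely
  the one with \<open>c y = Some x\<close>. So a word arises from at most one product of forms, and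
  only once.\<close>

lemma nc_coeff_prod_list_linear:
  assumes "\<And>x. nc_linear (s x)"
    and "\<And>x y. nc_coeff (s x) [y] = (if c y = Some x then 1 else 0)"
  shows "nc_coeff (prod_list (map s u)) w = (if map c w = map Some u then 1 else 0)"
proof (induction u arbitrary: w)
  case (Cons x u)
  show ?case
  proof (cases w)
    case w: (Cons y v)
    have "Abs_ncfps (\<lambda>v. nc_coeff (s x) (y # v)) = (if c y = Some x then 1 else 0)"
      using assms(1)[of x]
      by (intro ncfps_eqI) (auto simp: nc_coeff_one assms(2) nc_linear_def)
    then show ?thesis
      using w assms(1)[of x] by (simp add: nc_coeff_times_Cons nc_linear_def Cons.IH)
  qed (use assms(1)[of x] in \<open>simp add: nc_linear_def\<close>)
qed (simp add: nc_coeff_one)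

text \<open>
  The linear substitution \<open>s\<close> is encoded by the partial map \<open>c\<close> of letters: \<open>s x\<close> is the sum of
  the letters mapped to \<open>x\<close>.
\<close>
lemma nc_coeff_hev:
  fixes f :: "('x::finite, 'k::field_char_0) ncfps"
  assumes "\<And>x. nc_linear (s x)"
    and "\<And>x y. nc_coeff (s x) [y] = (if c y = Some x then 1 else 0)"
  shows "nc_coeff (nc.hev n f s) w =
    (if length w = n \<and> None \<notin> c ` set w then nc_coeff f (map (the \<circ> c) w) else 0)"
proof -
  have "nc_coeff (nc.hev n f s) w =
      (\<Sum>u | length u = n. if map c w = map Some u then nc_coeff f u else 0)"
    by (auto simp: nc.hev_def nc_coeff_sum nc_coeff_prod_list_linear[OF assms] intro!: sum.cong)
  also have "\<dots> = (\<Sum>u | length u = n. if u = map (the \<circ> c) w then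
      (if None \<notin> c ` set w then nc_coeff f u else 0) else 0)"
  proof (rule sum.cong)
    fix u :: "'x list"
    have "map c w = map Some u \<longleftrightarrow> None \<notin> c ` set w \<and> u = map (the \<circ> c) w"
    proof
      assume *: "map c w = map Some u"
      then have "c ` set w = Some ` set u"
        by (metis set_map)
      moreover have "map the (map c w) = map the (map Some u)"
        using * by simp
      ultimately show "None \<notin> c ` set w \<and> u = map (the \<circ> c) w"
        by (auto simp: comp_def)
    next
      assume *: "None \<notin> c ` set w \<and> u = map (the \<circ> c) w"
      then have "c y \<noteq> None" if "y \<in> set w" for y
        using that by (metis image_eqI)
      then show "map c w = map Some u"
        using * by auto
    qed
    then show "(if map c w = map Some u then nc_coeff f u else 0) =
      (if u = map (the \<circ> c) w then (if None \<notin> c ` set w then nc_coeff f u else 0) else 0)"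
      by auto
  qed simp
  finally show ?thesis
    by (auto simp: sum.delta)
qed

lemma nc_coeff_hev_var:
  "nc_coeff (nc.hev n f nc_var) w = (if length w = n then nc_coeff f w else 0)"
  by (subst nc_coeff_hev[where c = Some]) (auto simp: nc_coeff_var comp_def)

text \<open>Evaluating at the letters themselves returns the homogeneous parts, which turns
  identities between evaluations into identities between series.\<close>

lemma ncfps_eq_0_iff_hev: "f = 0 \<longleftrightarrow> (\<forall>n. nc.hev n f nc_var = 0)"
proof
  assume *: "\<forall>n. nc.hev n f nc_var = 0"
  show "f = 0"
  proof (rule ncfps_eqI)
    fix w
    show "nc_coeff f w = nc_coeff 0 w"
      using arg_cong[OF *[rule_format, of "length w"], of "\<lambda>g. nc_coeff g w"]
      by (simp add: nc_coeff_hev_var)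
  qed
qed simp

section \<open>Lie-like series at commuting arguments\<close>

text \<open>The coefficient of \<open>u \<otimes> v\<close> in the coproduct of the word
  \<open>w\<close>: the number of ways to split \<open>w\<close> into complementary subsequences
  \<open>u\<close> and \<open>v\<close>.\<close>

definition delta_coeff :: "'a list \<Rightarrow> 'a list \<Rightarrow> 'a list \<Rightarrow> 'k::field" where
  "delta_coeff w u v = nc_coeff (nc_coeff (prod_list
     (map (\<lambda>x. nc_tensor (nc_var x) 1 + nc_tensor 1 (nc_var x)) w)) u) v"

lemma delta_coeff_Nil: "delta_coeff [] u v = (if u = [] \<and> v = [] then 1 else 0)"
  by (auto simp: delta_coeff_def nc_coeff_one)

lemma delta_coeff_Cons:
  "(delta_coeff (x # w) u v :: 'k::field) =
     (case u of [] \<Rightarrow> 0 | y # u' \<Rightarrow> if y = x then delta_coeff w u' v else 0) +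
     (case v of [] \<Rightarrow> 0 | y # v' \<Rightarrow> if y = x then delta_coeff w u v' else 0)"
  for x :: 'a
proof -
  \<comment> \<open>In the iterated ring \<open>x \<otimes> 1\<close> is an outer letter, while
    \<open>1 \<otimes> x\<close> is an outer constant whose value is an inner letter. Multiplying by
    the one strips the first letter of \<open>u\<close>, by the other that of
    \<open>v\<close>.\<close>
  have 1: "nc_tensor (nc_var x) 1 = (nc_var x :: ('a, ('a, 'k) ncfps) ncfps)"
    by (intro ncfps_eqI) (auto simp: nc_tensor_def nc_coeff_var)
  have "nc_tensor 1 (nc_var x) =
      (Abs_ncfps (\<lambda>u. if u = [] then nc_var x else 0) :: ('a, ('a, 'k) ncfps) ncfps)"
    by (intro ncfps_eqI) (auto simp: nc_tensor_def nc_coeff_one)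
  moreover have "Abs_ncfps (\<lambda>w. 0) = (0 :: ('a, ('a, 'k) ncfps) ncfps)"
    by (intro ncfps_eqI) simp
  ultimately have 2: "nc_coeff (nc_tensor 1 (nc_var x) * F) u = nc_var x * nc_coeff F u"
    for F :: "('a, ('a, 'k) ncfps) ncfps"
    by (cases u) (simp_all add: nc_coeff_times_Cons)
  show ?thesis
    by (auto simp: delta_coeff_def 1 2 distrib_right nc_coeff_var_times split: list.split)
qed

lemma delta_coeff_eq_0: "length w \<noteq> length u + length v \<Longrightarrow> delta_coeff w u v = 0"
  by (induction w arbitrary: u v)
     (auto simp: delta_coeff_Nil delta_coeff_Cons split: list.split)

definition word_pairs :: "nat \<Rightarrow> ('a list \<times> 'a list) set" where
  "word_pairs n = {(u, v). length u + length v = n}"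

lemma finite_word_pairs [simp, intro]: "finite (word_pairs n :: ('a::finite list \<times> 'a list) set)"
  by (rule finite_subset[of _ "{u. length u \<le> n} \<times> {u. length u \<le> n}"])
     (auto simp: word_pairs_def)

lemma sum_reindex_neutral:
  assumes "finite S" "inj_on h T" "h ` T \<subseteq> S" "\<And>x. x \<in> S - h ` T \<Longrightarrow> g x = 0"
  shows "sum g S = (\<Sum>t\<in>T. g (h t))"
proof -
  have "sum g S = sum g (h ` T)"
    using assms by (intro sum.mono_neutral_right) auto
  then show ?thesis
    by (simp add: sum.reindex assms(2))
qed

text \<open>Compares the coefficients of \<open>u \<otimes> v\<close> on both sides of the equation
  defining \<open>lie_like\<close>.\<close>

lemma lie_like_delta_coeff:
  assumes "lie_like f" "(u, v) \<in> word_pairs n"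
  shows "(\<Sum>w | length w = n. nc_coeff f w * delta_coeff w u v) =
    (if v = [] then nc_coeff f u else 0) + (if u = [] then nc_coeff f v else 0)"
proof -
  have n: "length u + length v = n"
    using assms(2) by (simp add: word_pairs_def)
  have "(\<Sum>w | length w = n. nc_coeff f w * delta_coeff w u v) =
      (\<Sum>w | length w \<le> length u + length v. nc_coeff f w * delta_coeff w u v)"
    by (rule sum.mono_neutral_left) (auto simp: n delta_coeff_eq_0)
  also have "\<dots> = nc_coeff (nc_coeff (nc_coprod f) u) v"
    by (simp add: nc_coprod_def delta_coeff_def)
  also have "\<dots> = (if v = [] then nc_coeff f u else 0) + (if u = [] then nc_coeff f v else 0)"
    using assms(1) by (simp add: lie_like_def nc_tensor_def nc_coeff_one)
  finally show ?thesis .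
qed

context assoc_algebra
begin

lemma prod_list_commute:
  "(\<And>x. a * s x = s x * a) \<Longrightarrow> a * prod_list (map s u) = prod_list (map s u) * a"
proof (induction u)
  case (Cons x u)
  have "a * (s x * prod_list (map s u)) = s x * (a * prod_list (map s u))"
    using Cons.prems[of x] by (simp add: mult.assoc[symmetric])
  then show ?case
    using Cons by (simp add: mult.assoc)
qed simp

text \<open>Expanding the product picks \<open>s\<close> or \<open>s'\<close> at each position.
  Commutation collects the \<open>s\<close> factors on the left, and
  \<open>delta_coeff w u v\<close> counts the choices that leave \<open>u\<close> and
  \<open>v\<close>.\<close>

lemma prod_list_map_add:
  fixes s s' :: "'x::finite \<Rightarrow> 'r"
  assumes comm: "\<And>x y. s x * s' y = s' y * s x"
  shows "prod_list (map (\<lambda>x. s x + s' x) w) =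
    (\<Sum>(u, v)\<in>word_pairs (length w).
      sc (delta_coeff w u v) (prod_list (map s u) * prod_list (map s' v)))"
proof (induction w)
  case Nil
  have "word_pairs 0 = {([], [] :: 'x list)}"
    by (auto simp: word_pairs_def)
  then show ?case
    by (simp add: delta_coeff_Nil)
next
  case (Cons x w)
  let ?n = "length w" and ?p = "\<lambda>u v. prod_list (map s u) * prod_list (map s' v)"
  have 1: "(\<Sum>(u, v)\<in>word_pairs (Suc ?n).
        sc (case u of [] \<Rightarrow> 0 | y # u' \<Rightarrow> if y = x then delta_coeff w u' v else 0) (?p u v))
      = (\<Sum>(u, v)\<in>word_pairs ?n. sc (delta_coeff w u v) (?p (x # u) v))"
    by (subst sum_reindex_neutral[where h = "\<lambda>(u, v). (x # u, v)" and T = "word_pairs ?n"])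
       (auto simp: word_pairs_def inj_on_def image_iff case_prod_beta split: list.split
          intro!: sum.cong intro: finite_word_pairs[unfolded word_pairs_def])
  have 2: "(\<Sum>(u, v)\<in>word_pairs (Suc ?n).
        sc (case v of [] \<Rightarrow> 0 | y # v' \<Rightarrow> if y = x then delta_coeff w u v' else 0) (?p u v))
      = (\<Sum>(u, v)\<in>word_pairs ?n. sc (delta_coeff w u v) (?p u (x # v)))"
    by (subst sum_reindex_neutral[where h = "\<lambda>(u, v). (u, x # v)" and T = "word_pairs ?n"])
       (auto simp: word_pairs_def inj_on_def image_iff case_prod_beta split: list.split
          intro!: sum.cong intro: finite_word_pairs[unfolded word_pairs_def])
  have 3: "s' x * ?p u v = ?p u (x # v)" for u v
    using prod_list_commute[of "s' x" s u] comm by (simp add: mult.assoc[symmetric])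
  have "prod_list (map (\<lambda>x. s x + s' x) (x # w)) =
      s x * (\<Sum>(u, v)\<in>word_pairs ?n. sc (delta_coeff w u v) (?p u v)) +
      s' x * (\<Sum>(u, v)\<in>word_pairs ?n. sc (delta_coeff w u v) (?p u v))"
    by (simp add: Cons.IH distrib_right)
  also have "s x * (\<Sum>(u, v)\<in>word_pairs ?n. sc (delta_coeff w u v) (?p u v)) =
      (\<Sum>(u, v)\<in>word_pairs ?n. sc (delta_coeff w u v) (?p (x # u) v))"
    unfolding sum_distrib_left by (rule sum.cong) (auto simp: mult.assoc)
  also have "s' x * (\<Sum>(u, v)\<in>word_pairs ?n. sc (delta_coeff w u v) (?p u v)) =
      (\<Sum>(u, v)\<in>word_pairs ?n. sc (delta_coeff w u v) (?p u (x # v)))"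
    unfolding sum_distrib_left by (rule sum.cong) (auto simp only: mult_scale_right 3 split: prod.split)
  also have "(\<Sum>(u, v)\<in>word_pairs ?n. sc (delta_coeff w u v) (?p (x # u) v)) +
      (\<Sum>(u, v)\<in>word_pairs ?n. sc (delta_coeff w u v) (?p u (x # v))) =
      (\<Sum>(u, v)\<in>word_pairs (length (x # w)). sc (delta_coeff (x # w) u v) (?p u v))"
    unfolding 1[symmetric] 2[symmetric] sum.distrib[symmetric]
    by (intro sum.cong) (auto simp: delta_coeff_Cons scale_left_distrib)
  finally show ?case .
qed

text \<open>The coproduct of \<open>f\<close> is mapped to \<open>f (s + s')\<close> by \<open>a \<otimes> b \<mapsto> a(s) b(s')\<close>.\<close>
lemma hev_lie_like_add:
  assumes "lie_like f" and comm: "\<And>x y. s x * s' y = s' y * s x"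
  shows "hev n f (\<lambda>x. s x + s' x) = hev n f s + hev n f s'"
proof -
  let ?p = "\<lambda>u v. prod_list (map s u) * prod_list (map s' v)"
  have "hev n f (\<lambda>x. s x + s' x) = (\<Sum>w | length w = n. \<Sum>(u, v)\<in>word_pairs n.
      sc (nc_coeff f w * delta_coeff w u v) (?p u v))"
    unfolding hev_def
    by (intro sum.cong) (auto simp: prod_list_map_add[OF comm] scale_sum_right case_prod_beta)
  also have "\<dots> = (\<Sum>(u, v)\<in>word_pairs n.
      sc (\<Sum>w | length w = n. nc_coeff f w * delta_coeff w u v) (?p u v))"
    by (subst sum.swap) (simp add: scale_sum_left case_prod_beta)
  also have "\<dots> = (\<Sum>(u, v)\<in>word_pairs n. if v = [] then sc (nc_coeff f u) (?p u v) else 0) +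
      (\<Sum>(u, v)\<in>word_pairs n. if u = [] then sc (nc_coeff f v) (?p u v) else 0)"
    unfolding sum.distrib[symmetric]
    by (rule sum.cong)
       (auto simp: lie_like_delta_coeff[OF assms(1)] scale_left_distrib)
  also have "(\<Sum>(u, v)\<in>word_pairs n. if v = [] then sc (nc_coeff f u) (?p u v) else 0) = hev n f s"
    unfolding hev_def
    by (subst sum_reindex_neutral[where h = "\<lambda>u. (u, [])" and T = "{u. length u = n}"])
       (auto simp: word_pairs_def inj_on_def intro: finite_word_pairs[unfolded word_pairs_def])
  also have "(\<Sum>(u, v)\<in>word_pairs n. if u = [] then sc (nc_coeff f v) (?p u v) else 0) = hev n f s'"
    unfolding hev_def
    by (subst sum_reindex_neutral[where h = "\<lambda>u. ([], u)" and T = "{u. length u = n}"])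
       (auto simp: word_pairs_def inj_on_def intro: finite_word_pairs[unfolded word_pairs_def])
  finally show ?thesis .
qed

lemma hev_homogeneous: "hev n f (\<lambda>x. sc c (s x)) = sc (c ^ n) (hev n f s)"
proof -
  have "prod_list (map (\<lambda>x. sc c (s x)) u) = sc (c ^ length u) (prod_list (map s u))" for u
    by (induction u) simp_all
  then show ?thesis
    by (simp add: hev_def scale_sum_right mult.commute)
qed

text \<open>A Lie-like series with commuting arguments is additive in them, hence linear.\<close>
lemma hev_lie_like_commuting:
  assumes "lie_like f" "n \<noteq> 1" and comm: "\<And>x y. s x * s y = s y * s x"
  shows "hev n f s = 0"
proof -
  \<comment> \<open>Evaluation at the doubled arguments multiplies by \<open>2 ^ n\<close> by
    homogeneity and by \<open>2\<close> by additivity; in characteristic 0 these agree only for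
    \<open>n = 1\<close>.\<close>
  have "sc (2 ^ n) (hev n f s) = hev n f (\<lambda>x. s x + s x)"
    using hev_homogeneous[of n f 2 s] scale_left_distrib[of 1 1] by simp
  also have "\<dots> = sc 2 (hev n f s)"
    using hev_lie_like_add[OF assms(1) comm] scale_left_distrib[of 1 1] by simp
  finally have "sc (2 ^ n - 2) (hev n f s) = 0"
    by (simp add: scale_left_diff_distrib)
  moreover have "(2 ^ n - 2 :: 'k) \<noteq> 0"
  proof
    assume "(2 ^ n - 2 :: 'k) = 0"
    then have "of_nat (2 ^ n) = (of_nat 2 :: 'k)" by simp
    then have "(2::nat) ^ n = 2 ^ 1"
      unfolding of_nat_eq_iff by simp
    then show False
      using assms(2) by (subst (asm) power_inject_exp) auto
  qed
  ultimately show ?thesis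
    by simp
qed

definition ev2 :: "nat \<Rightarrow> (letter, 'k) ncfps \<Rightarrow> 'r \<Rightarrow> 'r \<Rightarrow> 'r" where
  "ev2 n f a b = hev n f (case_letter a b)"

lemma commutator_lie_like_ev2_commuting:
  assumes "commutator_lie_like f" "a * b = b * a"
  shows "ev2 n f a b = 0"
proof (cases "n = 1")
  \<comment> \<open>Additivity leaves degree one open; there the coefficients of \<open>X\<close>
    and \<open>Y\<close> vanish by hypothesis.\<close>
  case True
  then show ?thesis
    using assms(1) by (simp add: ev2_def hev_def commutator_lie_like_def sum_words_Suc
        words_0[simplified] UNIV_letter)
next
  case False
  then show ?thesis
    unfolding ev2_def using assms
    by (intro hev_lie_like_commuting) (auto simp: commutator_lie_like_def split: letter.split)
qed

lemma ev2_add: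
  assumes "commutator_lie_like f"
    and "a * c = c * a" "a * d = d * a" "b * c = c * b" "b * d = d * b"
  shows "ev2 n f (a + c) (b + d) = ev2 n f a b + ev2 n f c d"
proof -
  have "case_letter (a + c) (b + d) = (\<lambda>x. case_letter a b x + case_letter c d x)"
    by (auto split: letter.split)
  then show ?thesis
    unfolding ev2_def using assms
    by (auto simp: commutator_lie_like_def intro!: hev_lie_like_add split: letter.split)
qed

text \<open>The pair \<open>(c, 0)\<close> or \<open>(0, c)\<close> splits off by additivity, and
  its own value vanishes because its entries commute.\<close>

lemma ev2_add_commuting:
  assumes "commutator_lie_like f" "a * c = c * a" "b * c = c * b"
  shows "ev2 n f (a + c) b = ev2 n f a b" "ev2 n f a (b + c) = ev2 n f a b"
  using ev2_add[OF assms(1), of a c 0 b] ev2_add[OF assms(1), of a 0 c b]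
    commutator_lie_like_ev2_commuting[OF assms(1), of c 0]
    commutator_lie_like_ev2_commuting[OF assms(1), of 0 c] assms by simp_all

end

section \<open>Consequences of the pentagon in algebras with the \<open>P5\<close> relations\<close>

lemma UNIV_5: "UNIV = {0, 1, 2, 3, 4 :: 5}"
  using card_subset_eq[of "UNIV :: 5 set" "{0, 1, 2, 3, 4}"] by simp

lemma cases_5 [case_names 0 1 2 3 4]:
  obtains "(i :: 5) = 0" | "i = 1" | "i = 2" | "i = 3" | "i = 4"
  using UNIV_5 by blast

lemma UNIV_5_distinct:
  assumes "distinct [a, b, c, d, e :: 5]"
  shows "UNIV = {a, b, c, d, e}"
  using card_subset_eq[of "UNIV :: 5 set" "{a, b, c, d, e}"] assms by simp

text \<open>For a \<open>k\<close>-algebra \<open>'r\<close> this amounts to a Lie homomorphism from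
  \<open>P5\<close> to \<open>'r\<close> with the commutator bracket.\<close>

definition P5_system :: "(5 \<Rightarrow> 5 \<Rightarrow> 'r::ring_1) \<Rightarrow> bool" where
  "P5_system t \<longleftrightarrow> (\<forall>i. t i i = 0) \<and> (\<forall>i j. t i j = t j i) \<and> (\<forall>i. (\<Sum>j\<in>UNIV. t i j) = 0) \<and>
     (\<forall>i j k l. {i, j} \<inter> {k, l} = {} \<longrightarrow> t i j * t k l = t k l * t i j)"

lemma P5_systemD:
  assumes "P5_system t"
  shows "t i i = 0" "t i j = t j i" "(\<Sum>j\<in>UNIV. t i j) = 0"
    "{i, j} \<inter> {k, l} = {} \<Longrightarrow> t i j * t k l = t k l * t i j"
proof -
  note * = assms[unfolded P5_system_def]
  show "t i i = 0"
    by (rule *[THEN conjunct1, rule_format])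
  show "t i j = t j i"
    by (rule *[THEN conjunct2, THEN conjunct1, rule_format])
  show "(\<Sum>j\<in>UNIV. t i j) = 0"
    by (rule *[THEN conjunct2, THEN conjunct2, THEN conjunct1, rule_format])
  show "{i, j} \<inter> {k, l} = {} \<Longrightarrow> t i j * t k l = t k l * t i j"
    by (rule *[THEN conjunct2, THEN conjunct2, THEN conjunct2, rule_format])
qed

lemma P5_system_permute:
  assumes "P5_system t" "inj \<pi>"
  shows "P5_system (\<lambda>i j. t (\<pi> i) (\<pi> j))"
  unfolding P5_system_def
proof (intro conjI allI impI)
  show "t (\<pi> i) (\<pi> i) = 0" for i
    by (rule P5_systemD[OF assms(1)])
  show "t (\<pi> i) (\<pi> j) = t (\<pi> j) (\<pi> i)" for i j
    by (rule P5_systemD[OF assms(1)])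
  have "(\<Sum>j\<in>UNIV. t (\<pi> i) (\<pi> j)) = (\<Sum>j\<in>UNIV. t (\<pi> i) j)" for i
    using assms(2) finite_UNIV_inj_surj[of \<pi>] by (intro sum.reindex_bij_betw) (simp add: bij_def)
  then show "(\<Sum>j\<in>UNIV. t (\<pi> i) (\<pi> j)) = 0" for i
    by (simp add: P5_systemD(3)[OF assms(1)])
  show "t (\<pi> i) (\<pi> j) * t (\<pi> k) (\<pi> l) = t (\<pi> k) (\<pi> l) * t (\<pi> i) (\<pi> j)"
    if "{i, j} \<inter> {k, l} = {}" for i j k l
    using that assms(2) by (intro P5_systemD(4)[OF assms(1)]) (auto simp: inj_eq)
qed

definition pentagon :: "(letter, 'k::field) ncfps \<Rightarrow> bool" where
  "pentagon \<phi> \<longleftrightarrow> P5_hat_eq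
     (nc_at \<phi> (P5_X 1 2) (P5_X 2 3) + nc_at \<phi> (P5_X 3 4) (P5_X 4 5)
      + nc_at \<phi> (P5_X 5 1) (P5_X 1 2) + nc_at \<phi> (P5_X 2 3) (P5_X 3 4)
      + nc_at \<phi> (P5_X 4 5) (P5_X 5 1)) 0"

text \<open>Five indices have twelve cyclic arrangements up to reversal. Their pentagons are added
  with sign plus if \<open>p\<close> and \<open>q\<close> are neighbours and minus otherwise.
  Antisymmetry cancels all triples except those of \<open>K\<close>, each of which occurs
  twice.\<close>

lemma pentagon_sum:
  fixes F :: "5 \<Rightarrow> 5 \<Rightarrow> 5 \<Rightarrow> 'r::ring_1"
  assumes anti: "\<And>i j k. F k j i = - F i j k"
    and pent: "\<And>a b c d e. distinct [a, b, c, d, e] \<Longrightarrow>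
      F a b c + F c d e + F e a b + F b c d + F d e a = 0"
    and dist: "distinct [p, q, a, b, c]"
  defines "K \<equiv> (F p q a + F q a p + F a p q) + (F p q b + F q b p + F b p q)
      + (F p q c + F q c p + F c p q)"
  shows "K + K = 0"
proof -
  let ?P = "\<lambda>a b c d e. F a b c + F c d e + F e a b + F b c d + F d e a"
  note anti' = anti[of p a q] anti[of p b q] anti[of p c q]
    anti[of b p a] anti[of c p a] anti[of c p b] anti[of b q a] anti[of c q a] anti[of c q b]
    anti[of c b a] anti[of c a b] anti[of b c a]
  have "K + K =
      ?P p q a b c + ?P p q b a c + ?P p q a c b + ?P p q c a b + ?P p q b c a + ?P p q c b a
      - (?P p a q b c + ?P p b q a c + ?P p a q c b + ?P p c q a b + ?P p b q c a + ?P p c q b a)"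
    unfolding K_def anti' by (simp add: algebra_simps)
  also have "\<dots> = 0"
    using dist by (subst pent, force)+ simp
  finally show ?thesis .
qed

context assoc_algebra
begin

lemma double_eq_0:
  fixes x :: 'r
  assumes "x + x = 0"
  shows "x = 0"
proof -
  have "sc 2 x = 0"
    using scale_left_distrib[of 1 1 x] assms by (simp only: one_add_one scale_one)
  then show ?thesis
    by simp
qed

text \<open>The relations evaluate to 0 by the definition of \<open>P5_system\<close>. A bracket is
  evaluated through all lower degrees of its factors, hence the induction for arbitrary
  \<open>n\<close>.\<close>

lemma hev_lie_ideal:
  assumes "f \<in> lie_ideal P5_rels" and t: "P5_system t"
  shows "hev n f (\<lambda>(i, j). t i j) = 0"
  using assms(1)
proof (induction arbitrary: n)
  case (rel r)
  then consider i where "r = P5_X i i" | i j where "r = P5_X i j - P5_X j i"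
    | i where "r = (\<Sum>j\<in>UNIV. P5_X i j)"
    | i j k l where "{i, j} \<inter> {k, l} = {}" "r = nc_bracket (P5_X i j) (P5_X k l)"
    by (auto simp: P5_rels_def)
  then show ?case
  proof cases
    case (2 i j)
    then show ?thesis
      using P5_systemD(2)[OF t, of i j] by (simp add: P5_X_def hev_var)
  next
    case (3 i)
    then show ?thesis
      by (cases "n = 1") (simp_all add: P5_X_def hev_var hev_sum P5_systemD(3)[OF t])
  next
    case (4 i j k l)
    have "hev n (nc_var x * nc_var y) s = (if n = 2 then s x * s y else 0)"
      for x y :: "5 \<times> 5" and s
    proof -
      have "hev n (nc_var x * nc_var y) s =
          (\<Sum>m\<le>n. if m = 1 then (if n = 2 then s x * s y else 0) else 0)"
        unfolding hev_mult by (rule sum.cong) (auto simp: hev_var)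
      then show ?thesis
        by auto
    qed
    then show ?thesis
      using 4 P5_systemD(4)[OF t 4(1)] by (simp add: nc_bracket_def P5_X_def)
  qed (simp add: P5_X_def hev_var P5_systemD(1)[OF t])
next
  case (bracket f g)
  then show ?case
    by (simp add: nc_bracket_def hev_mult)
qed simp_all

lemma pentagon_ev2:
  assumes pent: "pentagon \<phi>" and t: "P5_system t" and dist: "distinct [a, b, c, d, e]"
  shows "ev2 n \<phi> (t a b) (t b c) + ev2 n \<phi> (t c d) (t d e) + ev2 n \<phi> (t e a) (t a b)
    + ev2 n \<phi> (t b c) (t c d) + ev2 n \<phi> (t d e) (t e a) = 0"
proof -
  \<comment> \<open>In the type \<open>5\<close> the index 5 is \<open>0\<close>, which receives the
    default value \<open>e\<close>.\<close>
  define \<pi> where "\<pi> = (\<lambda>_ :: 5. e)(1 := a, 2 := b, 3 := c, 4 := d)"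
  have "inj \<pi>"
    unfolding UNIV_5 inj_on_def using dist by (auto simp: \<pi>_def)
  define s where "s = (\<lambda>(i, j). t (\<pi> i) (\<pi> j))"
  have at: "hev n (nc_at \<phi> (P5_X i j) (P5_X k l)) s =
      ev2 n \<phi> (t (\<pi> i) (\<pi> j)) (t (\<pi> k) (\<pi> l))" for i j k l
    by (simp add: P5_X_def hev_at hev_var ev2_def s_def)
  have "hev n (nc_at \<phi> (P5_X 1 2) (P5_X 2 3) + nc_at \<phi> (P5_X 3 4) (P5_X 4 5)
      + nc_at \<phi> (P5_X 5 1) (P5_X 1 2) + nc_at \<phi> (P5_X 2 3) (P5_X 3 4)
      + nc_at \<phi> (P5_X 4 5) (P5_X 5 1)) s = 0" (is "hev n ?f s = 0")
  proof -
    have "nc_hpart n ?f \<in> lie_ideal P5_rels"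
      using pent by (simp add: pentagon_def P5_hat_eq_def)
    from hev_lie_ideal[OF this P5_system_permute[OF t \<open>inj \<pi>\<close>], of n] show ?thesis
      by (simp add: hev_hpart s_def)
  qed
  then show ?thesis
    unfolding hev_linear at by (simp add: \<pi>_def)
qed

text \<open>Adding the row sums of \<open>a, b, c\<close> and subtracting those of
  \<open>d, e\<close> cancels the mixed terms and leaves twice the difference of the two
  sides.\<close>

lemma P5_system_triangle:
  fixes t :: "5 \<Rightarrow> 5 \<Rightarrow> 'r"
  assumes t: "P5_system t" and dist: "distinct [a, b, c, d, e]"
  shows "t a b + t b c + t a c = t d e"
proof -
  note U = UNIV_5_distinct[OF dist]
  note sym = P5_systemD(2)[OF t]
  have row: "t i a + t i b + t i c + t i d + t i e = 0" for i
    using P5_systemD(3)[OF t, of i] dist unfolding U by (simp add: add.assoc)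
  let ?x = "t a b + t b c + t a c - t d e"
  have "?x + ?x = (t a a + t a b + t a c + t a d + t a e) + (t b a + t b b + t b c + t b d + t b e)
      + (t c a + t c b + t c c + t c d + t c e) - (t d a + t d b + t d c + t d d + t d e)
      - (t e a + t e b + t e c + t e d + t e e)"
    by (simp add: P5_systemD(1)[OF t] sym[of b a] sym[of c a] sym[of c b] sym[of d a] sym[of d b]
        sym[of d c] sym[of e a] sym[of e b] sym[of e c] sym[of e d] algebra_simps)
  also have "\<dots> = 0"
    by (simp add: row)
  finally show ?thesis
    using double_eq_0[of ?x] by simp
qed

end

text \<open>Forgetting the index 5 and identifying complementary pairs in \<open>1, 2, 3, 4\<close>
  makes disjoint pairs commute trivially. The values stay free in \<open>X\<close> and
  \<open>Y\<close>, and only two terms of the pentagon survive.\<close>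

lemma two_cycle:
  fixes \<phi> :: "(letter, 'k::field_char_0) ncfps"
  assumes lie: "commutator_lie_like \<phi>" and pent: "pentagon \<phi>"
  shows "nc_at \<phi> nc_X nc_Y + nc_at \<phi> nc_Y nc_X = 0"
proof -
  define Z :: "(letter, 'k) ncfps" where "Z = - nc_X - nc_Y"
  \<comment> \<open>As \<open>1 + 2 + 3 + 4 = 0\<close> in the type \<open>5\<close>, the square of \<open>i + j\<close> tells apart the three pairings of \<open>1, 2, 3, 4\<close>.\<close>
  define t :: "5 \<Rightarrow> 5 \<Rightarrow> (letter, 'k) ncfps" where
    "t = (\<lambda>i j. if i = j \<or> i = 0 \<or> j = 0 then 0
       else if (i + j)\<^sup>2 = 4 then nc_X else if (i + j)\<^sup>2 = 0 then nc_Y else Z)"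
  have sq: "(i + j)\<^sup>2 = (k + l)\<^sup>2" if "i \<noteq> 0" "j \<noteq> 0" "k \<noteq> 0" "l \<noteq> 0" "i \<noteq> j" "k \<noteq> l"
    "{i, j} \<inter> {k, l} = {}" for i j k l :: 5
  proof -
    have dist: "distinct [i, j, k, l, 0]"
      using that by (simp, blast)
    have "i + j + k + l = (\<Sum>x\<in>UNIV. x)"
      unfolding UNIV_5_distinct[OF dist] using dist by (simp add: add.assoc)
    also have "\<dots> = 0"
      unfolding UNIV_5 by simp
    finally have "(i + j) + (k + l) = 0"
      by (simp only: add.assoc)
    then have "k + l = - (i + j)"
      by (rule minus_unique[symmetric])
    then show ?thesis
      by (simp only: power2_minus)
  qed
  have "P5_system t"
    unfolding P5_system_def
  proof (intro conjI allI impI)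
    show "t i i = 0" for i
      by (simp add: t_def)
    show "t i j = t j i" for i j
      by (simp add: t_def add.commute[of j i] eq_commute[of j i] disj_commute[of "j = 0" "i = 0"])
    show "(\<Sum>j\<in>UNIV. t i j) = 0" for i
      by (cases i rule: cases_5) (unfold UNIV_5, simp_all add: t_def Z_def)
    show "t i j * t k l = t k l * t i j" if "{i, j} \<inter> {k, l} = {}" for i j k l
      using sq[of i j k l] that by (auto simp: t_def)
  qed
  from nc.pentagon_ev2[OF pent this, of 1 2 3 4 0]
  have *: "nc.ev2 n \<phi> (t 1 2) (t 2 3) + nc.ev2 n \<phi> (t 3 4) (t 4 0) + nc.ev2 n \<phi> (t 0 1) (t 1 2)
      + nc.ev2 n \<phi> (t 2 3) (t 3 4) + nc.ev2 n \<phi> (t 4 0) (t 0 1) = 0" for n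
    by simp
  have t: "t 1 2 = nc_X" "t 2 3 = nc_Y" "t 3 4 = nc_X" "t 4 0 = 0" "t 0 1 = 0"
    by (simp_all add: t_def)
  \<comment> \<open>The other three terms have the commuting arguments \<open>(X, 0)\<close>,
    \<open>(0, X)\<close> and \<open>(0, 0)\<close>.\<close>
  have "nc.ev2 n \<phi> nc_X nc_Y + nc.ev2 n \<phi> nc_Y nc_X = 0" for n
    using *[of n] nc.commutator_lie_like_ev2_commuting[OF lie, of nc_X 0 n]
      nc.commutator_lie_like_ev2_commuting[OF lie, of 0 nc_X n]
      nc.commutator_lie_like_ev2_commuting[OF lie, of 0 "0 :: (letter, 'k) ncfps" n]
    by (simp add: t)
  then have "\<forall>n. nc.hev n (nc_at \<phi> nc_X nc_Y + nc_at \<phi> nc_Y nc_X) nc_var = 0"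
    by (simp add: nc.hev_at nc.hev_var nc.ev2_def)
  then show ?thesis
    by (rule ncfps_eq_0_iff_hev[THEN iffD2])
qed

section \<open>Additivity of the 3-cycle expression\<close>

context assoc_algebra
begin

text \<open>The 2-cycle relation in free variables specialises to every pair
  \<open>a, b\<close>.\<close>

lemma ev2_swap:
  assumes "commutator_lie_like \<phi>" "pentagon \<phi>"
  shows "ev2 n \<phi> b a = - ev2 n \<phi> a b"
proof -
  have "hev n (nc_at \<phi> nc_X nc_Y + nc_at \<phi> nc_Y nc_X) (case_letter a b) = 0"
    by (simp only: two_cycle[OF assms] hev_linear)
  then show ?thesis
    by (simp add: hev_at hev_var ev2_def add_eq_0_iff)
qed

text \<open>The degree-\<open>n\<close> part of the 3-cycle expression
  \<open>R(a, b)\<close>.\<close>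

definition tri :: "nat \<Rightarrow> (letter, 'k) ncfps \<Rightarrow> 'r \<Rightarrow> 'r \<Rightarrow> 'r" where
  "tri n \<phi> a b = ev2 n \<phi> a b + ev2 n \<phi> b (- a - b) + ev2 n \<phi> (- a - b) a"

text \<open>By the triangle relation \<open>t x p\<close> differs from
  \<open>- t p q - t q x\<close> by \<open>t y z\<close>, which commutes with \<open>t p q\<close>
  and \<open>t q x\<close> and may therefore be dropped. This turns the sums in
  \<open>pentagon_sum\<close> into values of \<open>tri\<close>.\<close>

lemma tri_P5_system:
  assumes lie: "commutator_lie_like \<phi>" and pent: "pentagon \<phi>"
    and t: "P5_system t" and dist: "distinct [p, q, a, b, c]"
  shows "tri n \<phi> (t p q) (t q a) + tri n \<phi> (t p q) (t q b) + tri n \<phi> (t p q) (t q c) = 0"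
proof -
  note sym = P5_systemD(2)[OF t]
  define F where "F = (\<lambda>i j k. ev2 n \<phi> (t i j) (t j k))"
  have tri: "F p q x + F q x p + F x p q = tri n \<phi> (t p q) (t q x)"
    if "distinct [p, q, x, y, z]" for x y z
  proof -
    let ?w = "- t p q - t q x"
    have xp: "t x p = ?w + t y z"
      using P5_system_triangle[OF t that] by (simp add: sym[of x p] algebra_simps)
    have 1: "t p q * t y z = t y z * t p q" and 2: "t q x * t y z = t y z * t q x"
      using that by (auto intro!: P5_systemD(4)[OF t])
    then have 3: "?w * t y z = t y z * ?w"
      by (simp add: algebra_simps)
    show ?thesis
      unfolding F_def tri_def xp
      by (simp only: ev2_add_commuting(1)[OF lie 3 1] ev2_add_commuting(2)[OF lie 2 3])
  qed
  have "(F p q a + F q a p + F a p q) + (F p q b + F q b p + F b p q)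
      + (F p q c + F q c p + F c p q) = 0"
  proof (rule double_eq_0, rule pentagon_sum[OF _ _ dist])
    show "F k j i = - F i j k" for i j k
      unfolding F_def sym[of k j] sym[of j i] by (rule ev2_swap[OF lie pent])
  qed (unfold F_def, rule pentagon_ev2[OF pent t])
  then show ?thesis
    using tri[of a b c] tri[of b a c] tri[of c a b] dist by auto
qed

text \<open>In terms of \<open>c = - a - b\<close>, \<open>tri\<close> is invariant under rotation of \<open>a, b, c\<close> and odd under swaps.\<close>
lemma tri_additive:
  assumes lie: "commutator_lie_like \<phi>" and pent: "pentagon \<phi>"
    and t: "P5_system t"
  shows "tri n \<phi> (t 1 0) (t 0 2) + tri n \<phi> (t 1 0) (t 0 3) = tri n \<phi> (t 1 0) (t 0 2 + t 0 3)"
proof -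
  note swap = ev2_swap[OF lie pent]
  have "t 0 1 + t 0 2 + t 0 3 + t 0 4 = 0"
    using P5_systemD(1)[OF t, of 0] P5_systemD(3)[OF t, of 0] unfolding UNIV_5
    by (simp add: add.assoc)
  \<comment> \<open>With \<open>a = t 1 0\<close> and \<open>b = t 0 2 + t 0 3\<close> the last
    argument is \<open>- a - b\<close>. Replacing \<open>b\<close> by \<open>- a - b\<close> is an
    odd swap, so the third \<open>tri\<close> moves to the other side as
    \<open>tri n \<phi> a b\<close>.\<close>
  then have 4: "t 0 4 = - t 1 0 - (t 0 2 + t 0 3)"
    unfolding P5_systemD(2)[OF t, of 1 0] by (simp add: add_eq_0_iff)
  have "tri n \<phi> a (- a - b) = - tri n \<phi> a b" for a b
    by (simp add: tri_def swap[of n "- a - b" a] swap[of n b "- a - b"] swap[of n b a])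
  then have "tri n \<phi> (t 1 0) (t 0 4) = - tri n \<phi> (t 1 0) (t 0 2 + t 0 3)"
    unfolding 4 .
  with tri_P5_system[OF lie pent t, of 1 0 2 3 4 n]
  have "tri n \<phi> (t 1 0) (t 0 2) + tri n \<phi> (t 1 0) (t 0 3) - tri n \<phi> (t 1 0) (t 0 2 + t 0 3) = 0"
    by simp
  then show ?thesis
    by (simp only: right_minus_eq)
qed

end

section \<open>Linear endomorphisms of the series algebra\<close>

definition nc_lin :: "(('a, 'k::ring_1) ncfps \<Rightarrow> ('a, 'k) ncfps) \<Rightarrow> bool" where
  "nc_lin E \<longleftrightarrow> (\<forall>f g. E (f + g) = E f + E g) \<and> (\<forall>c f. E (nc_scale c f) = nc_scale c (E f))"

lemma nc_linI:
  "(\<And>f g. E (f + g) = E f + E g) \<Longrightarrow> (\<And>c f. E (nc_scale c f) = nc_scale c (E f)) \<Longrightarrow> nc_lin E"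
  by (simp add: nc_lin_def)

text \<open>Bundling the endomorphisms into a type makes them an instance of \<open>ring_1\<close>,
  so that \<open>assoc_algebra\<close> can be interpreted for them.\<close>

typedef (overloaded) ('a, 'k) nc_end = "{E :: ('a, 'k::field_char_0) ncfps \<Rightarrow> ('a, 'k) ncfps. nc_lin E}"
  morphisms nc_app Abs_nc_end
  by (rule exI[of _ "\<lambda>f. f"]) (simp add: nc_lin_def)

lemma nc_app_Abs: "nc_lin E \<Longrightarrow> nc_app (Abs_nc_end E) f = E f"
  by (simp add: Abs_nc_end_inverse)

lemma nc_end_eqI: "(\<And>f. nc_app E f = nc_app E' f) \<Longrightarrow> E = E'"
  by (metis nc_app_inject ext)

lemma nc_app_add: "nc_app E (f + g) = nc_app E f + nc_app E g"
  and nc_app_scale: "nc_app E (nc_scale c f) = nc_scale c (nc_app E f)"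
  using nc_app[of E] by (auto simp: nc_lin_def)

lemma nc_app_0: "nc_app E 0 = 0"
  using nc_app_scale[of E 0 0] by simp

lemma nc_app_uminus: "nc_app E (- f) = - nc_app E f"
  using nc_app_scale[of E "- 1" f] by simp

lemma nc_app_diff: "nc_app E (f - g) = nc_app E f - nc_app E g"
  using nc_app_add[of E f "- g"] by (simp add: nc_app_uminus)

lemmas nc_app_linear = nc_app_add nc_app_scale nc_app_0 nc_app_uminus nc_app_diff

instantiation nc_end :: (type, field_char_0) ring_1
begin

definition "0 = Abs_nc_end (\<lambda>_. 0)"
definition "1 = Abs_nc_end (\<lambda>f. f)"
definition "E + E' = Abs_nc_end (\<lambda>f. nc_app E f + nc_app E' f)"
definition "E - E' = Abs_nc_end (\<lambda>f. nc_app E f - nc_app E' f)"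
definition "- E = Abs_nc_end (\<lambda>f. - nc_app E f)"
definition "E * E' = Abs_nc_end (\<lambda>f. nc_app E (nc_app E' f))"

lemma nc_app_ring_simps:
  "nc_app 0 f = 0" "nc_app 1 f = f" "nc_app (E + E') f = nc_app E f + nc_app E' f"
  "nc_app (E - E') f = nc_app E f - nc_app E' f" "nc_app (- E) f = - nc_app E f"
  "nc_app (E * E') f = nc_app E (nc_app E' f)"
  unfolding zero_nc_end_def one_nc_end_def plus_nc_end_def minus_nc_end_def uminus_nc_end_def
    times_nc_end_def
  by (simp_all add: nc_app_Abs nc_lin_def nc_app_linear nc.scale_right_distrib
      nc.scale_right_diff_distrib)

instance
proof
  show "(0 :: ('a, 'b) nc_end) \<noteq> 1"
    using nc_app_ring_simps(1,2)[of "1 :: ('a, 'b) ncfps"] by auto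
qed (auto intro!: nc_end_eqI simp: nc_app_ring_simps nc_app_linear)

end

declare nc_app_ring_simps [simp]

lemma nc_app_sum: "nc_app (sum E A) f = (\<Sum>x\<in>A. nc_app (E x) f)"
  by (induction A rule: infinite_finite_induct) auto

definition nc_end_scale :: "'k::field_char_0 \<Rightarrow> ('a, 'k) nc_end \<Rightarrow> ('a, 'k) nc_end" where
  "nc_end_scale c E = Abs_nc_end (\<lambda>f. nc_scale c (nc_app E f))"

lemma nc_app_end_scale [simp]: "nc_app (nc_end_scale c E) f = nc_scale c (nc_app E f)"
  by (simp add: nc_end_scale_def nc_app_Abs nc_lin_def nc_app_linear nc.scale_right_distrib mult.commute)

interpretation endo: assoc_algebra nc_end_scale
  by standard
     (auto intro!: nc_end_eqI simp: nc_app_linear nc.scale_right_distrib nc.scale_left_distrib)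

section \<open>The adjoint representation on series\<close>

definition nc_lmul :: "('a, 'k::field_char_0) ncfps \<Rightarrow> ('a, 'k) nc_end" where
  "nc_lmul a = Abs_nc_end (\<lambda>f. a * f)"

definition nc_rmul :: "('a, 'k::field_char_0) ncfps \<Rightarrow> ('a, 'k) nc_end" where
  "nc_rmul a = Abs_nc_end (\<lambda>f. f * a)"

definition nc_ad :: "('a, 'k::field_char_0) ncfps \<Rightarrow> ('a, 'k) nc_end" where
  "nc_ad a = nc_lmul a - nc_rmul a"

lemma nc_app_mul [simp]: "nc_app (nc_lmul a) f = a * f" "nc_app (nc_rmul a) f = f * a"
  by (simp_all add: nc_lmul_def nc_rmul_def nc_app_Abs nc_lin_def distrib_left distrib_right)

lemma nc_app_ad [simp]: "nc_app (nc_ad a) f = a * f - f * a"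
  by (simp add: nc_ad_def)

lemma hev_lmul: "nc_app (endo.hev n f (\<lambda>x. nc_lmul (s x))) g = nc.hev n f s * g"
proof -
  have "nc_app (prod_list (map (\<lambda>x. nc_lmul (s x)) u)) g = prod_list (map s u) * g" for u
    by (induction u) (simp_all add: mult.assoc)
  then show ?thesis
    by (simp add: endo.hev_def nc.hev_def nc_app_sum sum_distrib_right)
qed

text \<open>Right multiplications compose, in reversed order, to a right multiplication, whose
  factor is recovered as the value at \<open>1\<close>.\<close>

lemma hev_rmul:
  "nc_app (endo.hev n f (\<lambda>x. nc_rmul (s x))) g = g * nc_app (endo.hev n f (\<lambda>x. nc_rmul (s x))) 1"
proof -
  have "nc_app (prod_list (map (\<lambda>x. nc_rmul (s x)) u)) g =
      g * nc_app (prod_list (map (\<lambda>x. nc_rmul (s x)) u)) 1" for u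
  proof (induction u)
    case (Cons x u)
    show ?case
      by (simp, subst Cons.IH) (simp add: mult.assoc)
  qed simp
  note * = this
  show ?thesis
    unfolding endo.hev_def nc_app_sum nc_app_end_scale sum_distrib_left
    by (rule sum.cong) (simp, subst *, simp)
qed

text \<open>\<open>nc_ad a\<close> is left multiplication by \<open>a\<close> plus right
  multiplication by \<open>- a\<close>. The two kinds commute, so a Lie-like series splits over
  them.\<close>

lemma ev2_ad:
  fixes f :: "(letter, 'k::field_char_0) ncfps"
  assumes "commutator_lie_like f"
  shows "\<exists>c. \<forall>g. nc_app (endo.ev2 n f (nc_ad a) (nc_ad b)) g = nc.ev2 n f a b * g + g * c"
proof -
  have neg: "nc_rmul (- a) = - nc_rmul a" for a :: "('a, 'k) ncfps"
    by (rule nc_end_eqI) simp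
  have eq: "nc_ad a = nc_lmul a + nc_rmul (- a)" for a :: "('a, 'k) ncfps"
    by (simp add: nc_ad_def neg)
  have comm: "nc_lmul a * nc_rmul b = nc_rmul b * nc_lmul a" for a b :: "('a, 'k) ncfps"
    by (rule nc_end_eqI) (simp add: mult.assoc)
  have case_eq: "case_letter (h a) (h b) = (\<lambda>x. h (case_letter a b x))"
    for h :: "('a, 'k) ncfps \<Rightarrow> ('a, 'k) nc_end" and a b
    by (auto split: letter.split)
  have "nc_app (endo.ev2 n f (nc_ad a) (nc_ad b)) g = nc_app (endo.ev2 n f (nc_lmul a) (nc_lmul b)) g
      + nc_app (endo.ev2 n f (nc_rmul (- a)) (nc_rmul (- b))) g" for g
    unfolding eq by (subst endo.ev2_add[OF assms]) (simp_all add: comm)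
  then have "nc_app (endo.ev2 n f (nc_ad a) (nc_ad b)) g = nc.ev2 n f a b * g
      + g * nc_app (endo.ev2 n f (nc_rmul (- a)) (nc_rmul (- b))) 1" for g
    unfolding endo.ev2_def nc.ev2_def case_eq hev_lmul by (subst (asm) hev_rmul)
  then show ?thesis
    by blast
qed

lemma tri_ad:
  assumes "commutator_lie_like f"
  shows "\<exists>c. \<forall>g. nc_app (endo.tri n f (nc_ad a) (nc_ad b)) g = nc.tri n f a b * g + g * c"
proof -
  have z: "- nc_ad a - nc_ad b = nc_ad (- a - b)"
    by (rule nc_end_eqI) (simp add: algebra_simps)
  obtain c1 where 1: "\<And>g. nc_app (endo.ev2 n f (nc_ad a) (nc_ad b)) g = nc.ev2 n f a b * g + g * c1"
    using ev2_ad[OF assms] by blast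
  obtain c2 where 2: "\<And>g. nc_app (endo.ev2 n f (nc_ad b) (nc_ad (- a - b))) g =
      nc.ev2 n f b (- a - b) * g + g * c2"
    using ev2_ad[OF assms] by blast
  obtain c3 where 3: "\<And>g. nc_app (endo.ev2 n f (nc_ad (- a - b)) (nc_ad a)) g =
      nc.ev2 n f (- a - b) a * g + g * c3"
    using ev2_ad[OF assms] by blast
  show ?thesis
    by (rule exI[of _ "c1 + c2 + c3"])
       (simp add: endo.tri_def nc.tri_def z 1 2 3 distrib_left distrib_right)
qed

text \<open>The coefficient of \<open>w\<close> in \<open>f\<close> is that of \<open>x # w\<close>
  in \<open>nc_var x * f\<close>, hence in \<open>f * nc_var x\<close>; but there only words ending
  in \<open>x\<close> occur.\<close>

lemma nc_coeff_central:
  assumes central: "\<And>x. f * nc_var x = nc_var x * f" and "w \<noteq> []" and "x \<noteq> last w"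
  shows "nc_coeff f w = 0"
proof -
  have "nc_coeff f w = nc_coeff (f * nc_var x) (x # w)"
    by (simp add: central nc_coeff_var_times)
  also have "\<dots> = 0"
    unfolding nc_coeff_times
  proof (rule sum.neutral, rule ballI)
    fix i
    have "drop i (x # w) \<noteq> [x]"
    proof
      assume "drop i (x # w) = [x]"
      then have "last (x # w) = x"
        by (metis append_take_drop_id last_snoc)
      with assms show False
        by simp
    qed
    then show "nc_coeff f (take i (x # w)) * nc_coeff (nc_var x) (drop i (x # w)) = 0"
      by (simp add: nc_coeff_var)
  qed
  finally show ?thesis .
qed

section \<open>Quadratic derivations of the series algebra\<close>

abbreviation nc_shift :: "'a \<Rightarrow> ('a, 'k) ncfps \<Rightarrow> ('a, 'k) ncfps" where
  "nc_shift x f \<equiv> Abs_ncfps (\<lambda>w. nc_coeff f (x # w))"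

text \<open>
  The continuous derivation sending each letter \<open>x\<close> to the quadratic part of \<open>d x\<close>: a letter \<open>x\<close>
  of a word of \<open>f\<close> is replaced by the two-letter words of \<open>d x\<close>.
\<close>
primrec deriv_coeff ::
  "('x::finite \<Rightarrow> ('x, 'k::field_char_0) ncfps) \<Rightarrow> ('x, 'k) ncfps \<Rightarrow> 'x list \<Rightarrow> 'k" where
  "deriv_coeff d f [] = 0"
| "deriv_coeff d f (a # w) =
     (case w of [] \<Rightarrow> 0 | b # v \<Rightarrow> \<Sum>x\<in>UNIV. nc_coeff (d x) [a, b] * nc_coeff f (x # v))
     + deriv_coeff d (nc_shift a f) w"

lemma nc_shift_simps:
  "nc_shift a (f + g) = nc_shift a f + nc_shift a g"
  "nc_shift a (nc_scale c f) = nc_scale c (nc_shift a f)"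
  "nc_shift a (f * g) = nc_scale (nc_coeff f []) (nc_shift a g) + nc_shift a f * g"
  by (auto intro!: ncfps_eqI simp: nc_coeff_times_Cons)

lemma deriv_coeff_add: "deriv_coeff d (f + g) w = deriv_coeff d f w + deriv_coeff d g w"
proof (induction w arbitrary: f g)
  case (Cons a w)
  show ?case
    unfolding deriv_coeff.simps nc_shift_simps Cons.IH
    by (cases w) (simp_all add: distrib_left sum.distrib)
qed simp

lemma deriv_coeff_scale: "deriv_coeff d (nc_scale c f) w = c * deriv_coeff d f w"
proof (induction w arbitrary: f)
  case (Cons a w)
  show ?case
    unfolding deriv_coeff.simps nc_shift_simps Cons.IH
    by (cases w) (simp_all add: distrib_left sum_distrib_left mult.left_commute)
qed simp

lemma deriv_coeff_times:
  "deriv_coeff d (f * g) w =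
     nc_coeff (Abs_ncfps (deriv_coeff d f) * g) w + nc_coeff (f * Abs_ncfps (deriv_coeff d g)) w"
proof (induction w arbitrary: f)
  case (Cons a w)
  let ?D = "\<lambda>f. Abs_ncfps (deriv_coeff d f)"
  \<comment> \<open>\<open>?q\<close> collects the terms in which the first two letters of
    \<open>a # w\<close> come from replacing one letter; all other terms keep \<open>a\<close> and
    derive the rest.\<close>
  let ?q = "\<lambda>f w. case w of [] \<Rightarrow> 0 | b # v \<Rightarrow> \<Sum>x\<in>UNIV. nc_coeff (d x) [a, b] * nc_coeff f (x # v)"
  have shift: "nc_shift a (?D f) = Abs_ncfps (?q f) + ?D (nc_shift a f)"
    by (intro ncfps_eqI) simp
  have q: "?q (f * g) w = nc_coeff f [] * ?q g w + nc_coeff (Abs_ncfps (?q f) * g) w"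
  proof (cases w)
    case (Cons b v)
    have "nc_shift b (Abs_ncfps (?q f)) = (\<Sum>x\<in>UNIV. nc_scale (nc_coeff (d x) [a, b]) (nc_shift x f))"
      by (intro ncfps_eqI) (simp add: nc_coeff_sum)
    then show ?thesis
      using Cons by (simp add: nc_coeff_times_Cons sum_distrib_right nc_coeff_sum sum.distrib
          sum_distrib_left algebra_simps)
  qed simp
  have "nc_coeff (?D f * g) (a # w) =
      nc_coeff (Abs_ncfps (?q f) * g) w + nc_coeff (?D (nc_shift a f) * g) w"
    unfolding nc_coeff_times_Cons shift distrib_right by simp
  moreover have "deriv_coeff d (nc_shift a (f * g)) w = nc_coeff f [] * deriv_coeff d (nc_shift a g) w +
      (nc_coeff (?D (nc_shift a f) * g) w + nc_coeff (nc_shift a f * ?D g) w)"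
    unfolding nc_shift_simps deriv_coeff_add deriv_coeff_scale Cons.IH ..
  moreover have "nc_coeff (f * ?D g) (a # w) =
      nc_coeff f [] * (?q g w + deriv_coeff d (nc_shift a g) w) + nc_coeff (nc_shift a f * ?D g) w"
    unfolding nc_coeff_times_Cons by simp
  ultimately show ?case
    by (simp only: deriv_coeff.simps q distrib_left add.assoc add.left_commute)
qed simp

definition nc_derivation :: "('x, 'k::field_char_0) nc_end \<Rightarrow> bool" where
  "nc_derivation E \<longleftrightarrow> (\<forall>f g. nc_app E (f * g) = nc_app E f * g + f * nc_app E g)"

definition nc_deriv :: "('x::finite \<Rightarrow> ('x, 'k::field_char_0) ncfps) \<Rightarrow> ('x, 'k) nc_end" where
  "nc_deriv d = Abs_nc_end (\<lambda>f. Abs_ncfps (deriv_coeff d f))"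

lemma nc_app_deriv: "nc_app (nc_deriv d) f = Abs_ncfps (deriv_coeff d f)"
  unfolding nc_deriv_def
  by (intro nc_app_Abs nc_linI ncfps_eqI) (simp_all add: deriv_coeff_add deriv_coeff_scale)

lemma nc_derivation_deriv: "nc_derivation (nc_deriv d)"
  unfolding nc_derivation_def nc_app_deriv
  by (intro allI ncfps_eqI) (simp add: deriv_coeff_times)

lemma nc_app_deriv_var:
  "nc_app (nc_deriv d) (nc_var x) = nc_hpart 2 (d x)"
proof (rule ncfps_eqI)
  fix w
  have 0: "deriv_coeff d 0 w = 0" for w
    using deriv_coeff_scale[of d 0 0 w] by simp
  have 1: "deriv_coeff d 1 w = 0" for w
    using deriv_coeff_times[of d 1 1 w] by simp
  have shift: "nc_shift a (nc_var x) = (if a = x then 1 else 0)" for a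
    by (intro ncfps_eqI) (simp add: nc_coeff_var nc_coeff_one)
  show "nc_coeff (nc_app (nc_deriv d) (nc_var x)) w = nc_coeff (nc_hpart 2 (d x)) w"
  proof (cases w)
    case w: (Cons a v)
    show ?thesis
    proof (cases v)
      case v: (Cons b u)
      have "(\<Sum>y\<in>UNIV. nc_coeff (d y) [a, b] * nc_coeff (nc_var x) (y # u)) =
          (\<Sum>y\<in>UNIV. if y = x then nc_coeff (d x) [a, b] * nc_coeff 1 u else 0)"
        by (rule sum.cong) (auto simp: nc_coeff_var nc_coeff_one)
      also have "\<dots> = nc_coeff (nc_hpart 2 (d x)) w"
        by (simp add: w v nc_hpart_def nc_coeff_one)
      finally show ?thesis
        using 0 1 unfolding nc_app_deriv nc_coeff_Abs w v deriv_coeff.simps(2)[of d _ a] list.case shift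
        by (simp del: deriv_coeff.simps(2))
    qed (simp add: w nc_app_deriv nc_hpart_def shift 0 1)
  qed (simp add: nc_app_deriv nc_hpart_def)
qed

text \<open>Writing \<open>f\<close> as a constant plus the sum of \<open>x f\<^sub>x\<close> gives \<open>E f = \<Sum>x (E f\<^sub>x)\<close>.\<close>
lemma nc_derivation_eq_0:
  fixes E :: "('x::finite, 'k::field_char_0) nc_end"
  assumes der: "nc_derivation E" and var: "\<And>x. nc_app E (nc_var x) = 0"
  shows "E = 0"
proof -
  have E1: "nc_app E 1 = 0"
    using der[unfolded nc_derivation_def, rule_format, of 1 1] by simp
  have sum: "nc_app E (\<Sum>x\<in>A. h x) = (\<Sum>x\<in>A. nc_app E (h x))" for h and A :: "'x set"
    by (induction A rule: infinite_finite_induct) (simp_all add: nc_app_linear)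
  have E: "nc_app E f = (\<Sum>x\<in>UNIV. nc_var x * nc_app E (nc_shift x f))" for f
  proof -
    have "f = nc_scale (nc_coeff f []) 1 + (\<Sum>x\<in>UNIV. nc_var x * nc_shift x f)"
    proof (rule ncfps_eqI)
      show "nc_coeff f w =
          nc_coeff (nc_scale (nc_coeff f []) 1 + (\<Sum>x\<in>UNIV. nc_var x * nc_shift x f)) w" for w
        by (cases w) (auto simp: nc_coeff_sum nc_coeff_one nc_coeff_var nc_coeff_var_times)
    qed
    then have "nc_app E f =
        nc_app E (nc_scale (nc_coeff f []) 1 + (\<Sum>x\<in>UNIV. nc_var x * nc_shift x f))"
      by simp
    also have "\<dots> = (\<Sum>x\<in>UNIV. nc_var x * nc_app E (nc_shift x f))"
      unfolding nc_app_add nc_app_scale E1 sum der[unfolded nc_derivation_def, rule_format] var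
      by simp
    finally show ?thesis .
  qed
  \<comment> \<open>The equation \<open>E\<close> strips the first letter of the word and passes
    from \<open>f\<close> to a shift of it, hence the induction for all \<open>f\<close>.\<close>
  have "nc_coeff (nc_app E f) w = 0" for f w
    by (induction w arbitrary: f; subst E) (auto simp: nc_coeff_sum nc_coeff_var nc_coeff_var_times
        intro!: sum.neutral)
  then show ?thesis
    by (intro nc_end_eqI ncfps_eqI) simp
qed

lemma nc_derivation_intros:
  "nc_derivation 0"
  "nc_derivation E \<Longrightarrow> nc_derivation E' \<Longrightarrow> nc_derivation (E + E')"
  "nc_derivation E \<Longrightarrow> nc_derivation E' \<Longrightarrow> nc_derivation (E * E' - E' * E)"
  "nc_derivation (nc_ad a)"
  by (simp_all add: nc_derivation_def nc_app_linear algebra_simps)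

lemma nc_derivation_sum:
  "(\<And>x. x \<in> A \<Longrightarrow> nc_derivation (E x)) \<Longrightarrow> nc_derivation (sum E A)"
  by (induction A rule: infinite_finite_induct) (auto intro: nc_derivation_intros)

section \<open>A system of endomorphisms with the \<open>P5\<close> relations\<close>

datatype strand = S1 | S2 | S3

lemma UNIV_strand: "UNIV = {S1, S2, S3}"
  using strand.exhaust by auto

instance strand :: finite
  by standard (simp add: UNIV_strand)

text \<open>The generators with indices 5 and \<open>k\<close>, where 5 is \<open>0\<close>. Three
  of them are free, and the value at 4 is forced by the row relation.\<close>

definition strand_var :: "5 \<Rightarrow> (strand, 'k::field_char_0) ncfps" where
  "strand_var k = (if k = 0 then 0 else if k = 1 then nc_var S1 else if k = 2 then nc_var S2
     else if k = 3 then nc_var S3 else - nc_var S1 - nc_var S2 - nc_var S3)"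

lemma strand_var_simps:
  "strand_var 0 = 0" "strand_var 1 = nc_var S1" "strand_var 2 = nc_var S2"
  "strand_var 3 = nc_var S3" "strand_var 4 = - nc_var S1 - nc_var S2 - nc_var S3"
  by (simp_all add: strand_var_def)

lemma strand_var_sum: "(\<Sum>k\<in>UNIV. strand_var k) = 0"
  unfolding UNIV_5 by (simp add: strand_var_simps)

text \<open>The commutator with \<open>t i j\<close> on the free ideal: in \<open>P5\<close> the sum
  \<open>t i j + t 0 i + t 0 j\<close> commutes with \<open>t 0 i\<close>, so
  \<open>[t i j, t 0 i] = [t 0 i, t 0 j]\<close>.\<close>

definition strand_deriv :: "5 \<Rightarrow> 5 \<Rightarrow> (strand, 'k::field_char_0) nc_end" where
  "strand_deriv i j = nc_deriv (\<lambda>x.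
     let k = (case x of S1 \<Rightarrow> 1 | S2 \<Rightarrow> 2 | S3 \<Rightarrow> 3) in
     if k = i then nc_bracket (strand_var i) (strand_var j)
     else if k = j then nc_bracket (strand_var j) (strand_var i) else 0)"

lemma nc_hpart_bracket:
  assumes "nc_linear f" "nc_linear g"
  shows "nc_hpart 2 (nc_bracket f g) = nc_bracket f g"
proof (rule ncfps_eqI)
  have "nc_coeff (f * g) w = 0" if "length w \<noteq> 2" "nc_linear f" "nc_linear g"
    for f g :: "('a, 'b) ncfps" and w
    unfolding nc_coeff_times
  proof (rule sum.neutral, rule ballI)
    fix i assume "i \<in> {..length w}"
    then have "length (take i w) \<noteq> 1 \<or> length (drop i w) \<noteq> 1"
      using that(1) by auto
    then show "nc_coeff f (take i w) * nc_coeff g (drop i w) = 0"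
      using that(2,3) by (auto simp: nc_linear_def)
  qed
  then show "nc_coeff (nc_hpart 2 (nc_bracket f g)) w = nc_coeff (nc_bracket f g) w" for w
    using assms by (simp add: nc_hpart_def nc_bracket_def)
qed

lemma nc_hpart_0: "nc_hpart n 0 = 0"
  by (rule ncfps_eqI) (simp add: nc_hpart_def)

lemma strand_linear: "nc_linear (strand_var k)"
  by (simp add: strand_var_def)

lemma strand_deriv_var:
  assumes "i \<noteq> j" "i \<noteq> 0" "j \<noteq> 0"
  shows "nc_app (strand_deriv i j) (strand_var k :: (strand, 'k::field_char_0) ncfps) =
    (if k = i then nc_bracket (strand_var i) (strand_var j)
     else if k = j then nc_bracket (strand_var j) (strand_var i) else 0)"
proof -
  note [simp] = nc_hpart_bracket[OF strand_linear strand_linear] nc_hpart_0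
  have 1: "nc_app (strand_deriv i j) (strand_var 1 :: (strand, 'k) ncfps) =
    (if 1 = i then nc_bracket (strand_var i) (strand_var j)
     else if 1 = j then nc_bracket (strand_var j) (strand_var i) else 0)"
    and 2: "nc_app (strand_deriv i j) (strand_var 2 :: (strand, 'k) ncfps) =
    (if 2 = i then nc_bracket (strand_var i) (strand_var j)
     else if 2 = j then nc_bracket (strand_var j) (strand_var i) else 0)"
    and 3: "nc_app (strand_deriv i j) (strand_var 3 :: (strand, 'k) ncfps) =
    (if 3 = i then nc_bracket (strand_var i) (strand_var j)
     else if 3 = j then nc_bracket (strand_var j) (strand_var i) else 0)"
    unfolding strand_deriv_def strand_var_simps(2-4) nc_app_deriv_var by simp_all
  show ?thesis
  proof (cases k rule: cases_5)
    \<comment> \<open>The fourth variable is minus the sum of the letters. The brackets at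
      \<open>i\<close> and \<open>j\<close> cancel in its image unless 4 is one of them, so it obeys
      the same rule as a letter.\<close>
    case 4
    have "strand_var 4 = - strand_var 1 - strand_var 2 - (strand_var 3 :: (strand, 'k) ncfps)"
      by (simp add: strand_var_simps)
    then have "nc_app (strand_deriv i j) (strand_var 4 :: (strand, 'k) ncfps) = - nc_app (strand_deriv i j) (strand_var 1)
        - nc_app (strand_deriv i j) (strand_var 2) - nc_app (strand_deriv i j) (strand_var 3)"
      by (simp only: nc_app_linear)
    then show ?thesis
      unfolding 4 1 2 3 using assms
      by (cases i rule: cases_5; cases j rule: cases_5) (simp_all add: nc_bracket_def)
  qed (use 1 2 3 assms in \<open>simp_all add: strand_var_simps(1) nc_app_0\<close>)
qed

definition strand_system :: "5 \<Rightarrow> 5 \<Rightarrow> (strand, 'k::field_char_0) nc_end" where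
  "strand_system i j = (if i = j then 0 else if i = 0 then nc_ad (strand_var j)
     else if j = 0 then nc_ad (strand_var i) else strand_deriv i j)"

lemma strand_derivation: "nc_derivation (strand_system i j)"
  by (simp add: strand_system_def nc_derivation_intros strand_deriv_def nc_derivation_deriv)

lemma nc_derivation_bracket:
  assumes "nc_derivation E"
  shows "nc_app E (nc_bracket f g) = nc_bracket (nc_app E f) g + nc_bracket f (nc_app E g)"
  using assms by (simp add: nc_derivation_def nc_bracket_def nc_app_linear algebra_simps)

text \<open>Reduces the relations between the derivations to a check on the variables.\<close>

lemma strand_derivation_eqI:
  assumes "nc_derivation E" "nc_derivation E'"
    and "\<And>k. nc_app E (strand_var k) = nc_app E' (strand_var k)"
  shows "E = E'"
proof -
  have "E - E' = 0"
  proof (rule nc_derivation_eq_0)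
    show "nc_derivation (E - E')"
      using assms(1,2) by (simp add: nc_derivation_def algebra_simps)
    show "nc_app (E - E') (nc_var x) = 0" for x
      using assms(3)[of 1] assms(3)[of 2] assms(3)[of 3]
      by (cases x) (simp_all add: strand_var_simps)
  qed
  then show ?thesis
    by simp
qed

lemma nc_bracket_0 [simp]: "nc_bracket f 0 = 0" "nc_bracket 0 f = 0" "nc_bracket f f = 0"
  by (simp_all add: nc_bracket_def)

text \<open>The commutator of a derivation \<open>E\<close> with \<open>nc_ad a\<close> is
  \<open>nc_ad\<close> of the image of \<open>a\<close> under \<open>E\<close>.\<close>

lemma nc_derivation_ad_commute:
  assumes "nc_derivation E" "nc_app E a = 0"
  shows "nc_ad a * E = E * nc_ad a"
  using assms by (intro nc_end_eqI) (simp add: nc_derivation_def nc_app_linear)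

lemma strand_system_commute:
  assumes "{i, j} \<inter> {k, l} = {}"
  shows "strand_system i j * strand_system k l = strand_system k l * (strand_system i j :: (strand, 'k::field_char_0) nc_end)"
proof -
  define E F :: "(strand, 'k) nc_end" where "E = strand_system i j" and "F = strand_system k l"
  have ad: "nc_ad (strand_var a) * strand_system b c =
      strand_system b c * (nc_ad (strand_var a) :: (strand, 'k) nc_end)"
    if "a \<notin> {b, c}" "b \<noteq> 0" "c \<noteq> 0" for a b c :: 5
    using that by (intro nc_derivation_ad_commute strand_derivation)
      (auto simp: strand_system_def strand_deriv_var)
  consider "i = j \<or> k = l" | "i \<noteq> j" "k \<noteq> l" "0 \<in> {i, j}" | "i \<noteq> j" "k \<noteq> l" "0 \<in> {k, l}"
    | "i \<noteq> j" "k \<noteq> l" "0 \<notin> {i, j, k, l}"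
    by auto
  then show ?thesis
  proof cases
    case 1
    then show ?thesis
      by (auto simp: strand_system_def)
  next
    case 2
    then have "strand_system i j = (nc_ad (strand_var (if i = 0 then j else i)) :: (strand, 'k) nc_end)"
      by (auto simp: strand_system_def)
    then show ?thesis
      using 2 assms ad[of "if i = 0 then j else i" k l] by (auto split: if_splits)
  next
    case 3
    then have "strand_system k l = (nc_ad (strand_var (if k = 0 then l else k)) :: (strand, 'k) nc_end)"
      by (auto simp: strand_system_def)
    then show ?thesis
      using 3 assms ad[of "if k = 0 then l else k" i j] by (auto split: if_splits)
  next
    case 4
    then have E: "nc_app E (strand_var m) = (if m = i then nc_bracket (strand_var i) (strand_var j)
        else if m = j then nc_bracket (strand_var j) (strand_var i) else 0)"
      and F: "nc_app F (strand_var m) = (if m = k then nc_bracket (strand_var k) (strand_var l)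
        else if m = l then nc_bracket (strand_var l) (strand_var k) else 0)" for m
      by (simp_all add: E_def F_def strand_system_def strand_deriv_var)
    have der: "nc_derivation E" "nc_derivation F"
      by (simp_all add: E_def F_def strand_derivation)
    \<comment> \<open>The image of any variable under \<open>F\<close> involves only those of
      \<open>k\<close> and \<open>l\<close>, which \<open>E\<close> kills, and vice versa.\<close>
    have "E * F - F * E = 0"
    proof (rule strand_derivation_eqI)
      show "nc_derivation (E * F - F * E)"
        by (rule nc_derivation_intros(3)[OF der])
      show "nc_app (E * F - F * E) (strand_var m) = nc_app 0 (strand_var m)" for m
        using assms
        by (auto simp: E F nc_derivation_bracket[OF der(1)] nc_derivation_bracket[OF der(2)] nc_app_0)
    qed (rule nc_derivation_intros)
    then show ?thesis
      by (simp add: E_def F_def)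
  qed
qed

lemma strand_system_sum: "(\<Sum>j\<in>UNIV. strand_system i j) = (0 :: (strand, 'k::field_char_0) nc_end)"
proof (rule strand_derivation_eqI)
  show "nc_derivation (\<Sum>j\<in>UNIV. strand_system i j)"
    by (intro nc_derivation_sum strand_derivation)
  fix k
  let ?x = "strand_var :: 5 \<Rightarrow> (strand, 'k) ncfps"
  have br: "nc_bracket f (\<Sum>j\<in>A. g j) = (\<Sum>j\<in>A. nc_bracket f (g j))"
    "nc_bracket (\<Sum>j\<in>A. g j) f = (\<Sum>j\<in>A. nc_bracket (g j) f)"
    for f :: "(strand, 'k) ncfps" and g and A :: "5 set"
    by (simp_all add: nc_bracket_def sum_subtractf sum_distrib_left sum_distrib_right)
  have "(\<Sum>j\<in>UNIV. nc_app (strand_system i j) (?x k)) = 0"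
  proof (cases "i = 0")
    case True
    have "(\<Sum>j\<in>UNIV. nc_app (strand_system i j) (?x k)) = (\<Sum>j\<in>UNIV. nc_bracket (?x j) (?x k))"
      using True by (intro sum.cong) (auto simp: strand_system_def nc_bracket_def strand_var_simps(1))
    then show ?thesis
      by (simp add: br(2)[symmetric] strand_var_sum)
  next
    case i: False
    show ?thesis
    proof (cases "k = i")
      case True
      have "(\<Sum>j\<in>UNIV. nc_app (strand_system i j) (?x k)) = (\<Sum>j\<in>UNIV. nc_bracket (?x i) (?x j))"
        using True i
        by (intro sum.cong) (auto simp: strand_system_def strand_deriv_var nc_bracket_def strand_var_simps(1))
      then show ?thesis
        by (simp add: br(1)[symmetric] strand_var_sum)
    next
      \<comment> \<open>Only \<open>j = 0\<close>, acting as an inner derivation, and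
        \<open>j = k\<close> contribute; their brackets are opposite.\<close>
      case False
      have "(\<Sum>j\<in>UNIV. nc_app (strand_system i j) (?x k)) =
          (\<Sum>j\<in>UNIV. (if j = 0 then nc_bracket (?x i) (?x k) else 0)
            + (if j = k then nc_bracket (?x k) (?x i) else 0))"
        using False i
        by (intro sum.cong) (auto simp: strand_system_def strand_deriv_var nc_bracket_def strand_var_simps(1))
      then show ?thesis
        by (simp add: sum.distrib) (simp add: nc_bracket_def)
    qed
  qed
  then show "nc_app (\<Sum>j\<in>UNIV. strand_system i j) (?x k) = nc_app 0 (?x k)"
    by (simp add: nc_app_sum)
qed (rule nc_derivation_intros)

lemma P5_system_strand: "P5_system (strand_system :: _ \<Rightarrow> _ \<Rightarrow> (strand, 'k::field_char_0) nc_end)"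
  unfolding P5_system_def
proof (intro conjI allI impI)
  show "strand_system i i = 0" for i
    by (simp add: strand_system_def)
  show "strand_system i j = (strand_system j i :: (strand, 'k) nc_end)" for i j
  proof (rule strand_derivation_eqI[OF strand_derivation strand_derivation])
    show "nc_app (strand_system i j) (strand_var k) =
        nc_app (strand_system j i :: (strand, 'k) nc_end) (strand_var k)" for k
      by (auto simp: strand_system_def strand_deriv_var)
  qed
qed (rule strand_system_sum, rule strand_system_commute)

section \<open>Additivity in free variables and the 3-cycle relation\<close>

lemma strand_tri_additive:
  fixes \<phi> :: "(letter, 'k::field_char_0) ncfps"
  assumes lie: "commutator_lie_like \<phi>" and pent: "pentagon \<phi>" and "w \<noteq> []"
  shows "nc_coeff (nc.tri n \<phi> (nc_var S1) (nc_var S2)) w + nc_coeff (nc.tri n \<phi> (nc_var S1) (nc_var S3)) w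
    = nc_coeff (nc.tri n \<phi> (nc_var S1) (nc_var S2 + nc_var S3)) w"
proof -
  let ?A = "nc_var S1 :: (strand, 'k) ncfps" and ?B = "nc_var S2 :: (strand, 'k) ncfps"
    and ?C = "nc_var S3 :: (strand, 'k) ncfps"
  have t: "strand_system 1 0 = nc_ad ?A" "strand_system 0 2 = nc_ad ?B" "strand_system 0 3 = nc_ad ?C"
    by (simp_all add: strand_system_def strand_var_simps)
  have BC: "nc_ad ?B + nc_ad ?C = nc_ad (?B + ?C)"
    by (rule nc_end_eqI) (simp add: algebra_simps)
  have additive: "endo.tri n \<phi> (nc_ad ?A) (nc_ad ?B) + endo.tri n \<phi> (nc_ad ?A) (nc_ad ?C)
      = endo.tri n \<phi> (nc_ad ?A) (nc_ad (?B + ?C))"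
    using endo.tri_additive[OF lie pent P5_system_strand, of n] unfolding t BC .
  obtain c1 where 1: "\<And>g. nc_app (endo.tri n \<phi> (nc_ad ?A) (nc_ad ?B)) g = nc.tri n \<phi> ?A ?B * g + g * c1"
    using tri_ad[OF lie] by blast
  obtain c2 where 2: "\<And>g. nc_app (endo.tri n \<phi> (nc_ad ?A) (nc_ad ?C)) g = nc.tri n \<phi> ?A ?C * g + g * c2"
    using tri_ad[OF lie] by blast
  obtain c3 where 3: "\<And>g. nc_app (endo.tri n \<phi> (nc_ad ?A) (nc_ad (?B + ?C))) g =
      nc.tri n \<phi> ?A (?B + ?C) * g + g * c3"
    using tri_ad[OF lie] by blast
  define s where "s = nc.tri n \<phi> ?A ?B + nc.tri n \<phi> ?A ?C - nc.tri n \<phi> ?A (?B + ?C)"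
  define c where "c = c1 + c2 - c3"
  \<comment> \<open>At \<open>g = 1\<close> this gives \<open>c = - s\<close>, so \<open>s\<close>
    is central and all its nonconstant coefficients vanish.\<close>
  have sc: "s * g + g * c = 0" for g
    using arg_cong[OF additive, of "\<lambda>E. nc_app E g"]
    by (simp add: 1 2 3 s_def c_def algebra_simps)
  have "c = - s"
    using sc[of 1] by (simp add: add_eq_0_iff)
  then have central: "s * g = g * s" for g
    using sc[of g] by simp
  obtain x where "x \<noteq> last w"
    by (cases "last w") auto
  then have "nc_coeff s w = 0"
    using central assms(3) by (intro nc_coeff_central)
  then show ?thesis
    by (simp add: s_def)
qed

text \<open>The left-hand side is the coefficient of \<open>x \<otimes> y\<close> in the coproduct,
  and neither \<open>f \<otimes> 1\<close> nor \<open>1 \<otimes> f\<close> has such a term.\<close>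

lemma lie_like_degree_two:
  assumes "lie_like f"
  shows "nc_coeff f [x, y] + nc_coeff f [y, x] = 0"
proof -
  have "(\<Sum>w | length w = 2. nc_coeff f w * delta_coeff w [x] [y]) = 0"
    using lie_like_delta_coeff[OF assms, of "[x]" "[y]" 2] by (simp add: word_pairs_def)
  moreover have "(\<Sum>w | length w = 2. nc_coeff f w * delta_coeff w [x] [y]) =
      (\<Sum>a\<in>UNIV. \<Sum>b\<in>UNIV. (if a = x then if b = y then nc_coeff f [a, b] else 0 else 0)
        + (if a = y then if b = x then nc_coeff f [a, b] else 0 else 0))"
    unfolding numeral_2_eq_2 sum_words_Suc words_0
    by (intro sum.cong) (auto simp: delta_coeff_Cons delta_coeff_Nil)
  moreover have "(\<Sum>b\<in>UNIV. if a = x' then if b = y' then nc_coeff f [a, b] else 0 else 0) =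
      (if a = x' then nc_coeff f [x', y'] else 0)" for a x' y'
    by simp
  ultimately show ?thesis
    by (simp add: sum.distrib)
qed

lemma three_cycle:
  fixes \<phi> :: "(letter, 'k::field_char_0) ncfps"
  assumes lie: "commutator_lie_like \<phi>" and c2: "c2 \<phi> = 0" and pent: "pentagon \<phi>"
    and Z: "nc_X + nc_Y + Z = 0"
  shows "nc_at \<phi> nc_X nc_Y + nc_at \<phi> nc_Y Z + nc_at \<phi> Z nc_X = 0"
proof -
  define R where "R = nc_at \<phi> nc_X nc_Y + nc_at \<phi> nc_Y Z + nc_at \<phi> Z nc_X"
  have Z: "Z = - nc_X - nc_Y"
    using minus_unique[OF Z] by simp
  have tri: "nc.tri n \<phi> a b = nc.hev n R (case_letter a b)"
    for n and a b :: "('x, 'k) ncfps"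
    by (simp add: R_def Z nc.hev_at nc.hev_var nc.tri_def nc.ev2_def)
  have small: "nc_coeff \<phi> w = 0" if "length w \<le> 2" for w
  proof -
    \<comment> \<open>The constant term is the degree-0 value at the commuting pair
      \<open>(1, 1)\<close>.\<close>
    have 0: "nc_coeff \<phi> [] = 0"
      using nc.commutator_lie_like_ev2_commuting[OF lie refl, of 0 "1 :: (letter, 'k) ncfps"]
      by (auto simp: nc.ev2_def nc.hev_def words_0[simplified] nc_coeff_one dest: arg_cong[of _ _ "\<lambda>f. nc_coeff f []"])
    have 1: "nc_coeff \<phi> [x] = 0" for x
      using lie by (cases x) (simp_all add: commutator_lie_like_def)
    have sym: "nc_coeff \<phi> [x, y] + nc_coeff \<phi> [y, x] = 0" for x y
      using lie by (intro lie_like_degree_two) (simp add: commutator_lie_like_def)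
    have 2: "nc_coeff \<phi> [x, y] = 0" for x y
      using sym[of x y] sym[of LX LX] sym[of LY LY] c2
      by (cases x; cases y) (auto simp: c2_def)
    show ?thesis
      using that 0 1 2 by (cases w rule: remdups_adj.cases) auto
  qed
  have "nc.hev n \<phi> s = 0" if "n \<le> 2" for n and s :: "letter \<Rightarrow> (letter, 'k) ncfps"
    using that small by (auto simp: nc.hev_def intro!: sum.neutral)
  then have tri_small: "nc.tri n \<phi> a b = 0" if "n \<le> 2" for n and a b :: "(letter, 'k) ncfps"
    using that by (simp add: nc.tri_def nc.ev2_def)
  let ?swap = "\<lambda>w. map (case_letter LY LX) w"
  have "case_letter nc_X nc_Y = (nc_var :: letter \<Rightarrow> (letter, 'k) ncfps)" and
    swap_eq: "case_letter nc_Y nc_X = (\<lambda>x. nc_var (case_letter LY LX x) :: (letter, 'k) ncfps)"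
    by (auto split: letter.split)
  then have R: "nc_coeff R w = nc_coeff (nc.tri (length w) \<phi> nc_X nc_Y) w" for w
    by (simp add: tri nc_coeff_hev_var)
  \<comment> \<open>Exchanging the letters of a word is exchanging the arguments of
    \<open>tri\<close>, which changes the sign.\<close>
  have R_swap: "nc_coeff R (?swap w) = - nc_coeff R w" for w
  proof -
    have "nc_coeff R (?swap w) = nc_coeff (nc.tri (length w) \<phi> nc_Y nc_X) w"
      unfolding tri swap_eq
      by (subst nc_coeff_hev[where c = "\<lambda>x. Some (case_letter LY LX x)"])
         (auto simp: nc_coeff_var comp_def split: letter.split)
    also have "nc.tri (length w) \<phi> nc_Y nc_X = - nc.tri (length w) \<phi> nc_X nc_Y"
      using nc.ev2_swap[OF lie pent, of _ nc_X nc_Y] nc.ev2_swap[OF lie pent, of _ nc_X "- nc_X - nc_Y"]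
        nc.ev2_swap[OF lie pent, of _ nc_Y "- nc_X - nc_Y"]
      by (simp add: nc.tri_def minus_diff_commute[of nc_Y])
    finally show ?thesis
      by (simp add: R)
  qed
  have two_Y: "nc_coeff R (u @ LY # v) = 0" if "LY \<in> set v" for u v
  proof -
    \<comment> \<open>Polarisation: \<open>col S T\<close> encodes the substitution of
      \<open>S1\<close> for \<open>X\<close> and \<open>S + T\<close> for \<open>Y\<close>, or of
      \<open>S\<close> alone when \<open>S = T\<close>. The word \<open>w\<close> lifts
      \<open>u @ LY # v\<close> using both \<open>S2\<close> and \<open>S3\<close>, so it can occur
      only on the side with \<open>S2 + S3\<close>.\<close>
    define col where "col = (\<lambda>S T x. if x = S1 then Some LX else if x \<in> {S, T} then Some LY else None)"
    define w where "w = map (case_letter S1 S2) u @ S2 # map (case_letter S1 S3) v"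
    have coeff: "nc_coeff (nc.tri (length w) \<phi> (nc_var S1) b) w =
        (if None \<notin> c ` set w then nc_coeff R (map (the \<circ> c) w) else 0)"
      if "nc_linear b" "\<And>x. nc_coeff b [x] = (if c x = Some LY then 1 else 0)"
        "\<And>x. c x = Some LX \<longleftrightarrow> x = S1"
      for b and c :: "strand \<Rightarrow> letter option"
      unfolding tri using that
      by (subst nc_coeff_hev[where c = c]) (auto simp: nc_coeff_var split: letter.split)
    have "S2 \<in> set w" "S3 \<in> set w"
      using that by (force simp: w_def)+
    have "nc_coeff (nc.tri (length w) \<phi> (nc_var S1) (nc_var S2)) w = 0"
      by (subst coeff[of _ "col S2 S2"]) (use \<open>S3 \<in> set w\<close> in \<open>force simp: col_def nc_coeff_var\<close>)+
    moreover have "nc_coeff (nc.tri (length w) \<phi> (nc_var S1) (nc_var S3)) w = 0"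
      by (subst coeff[of _ "col S3 S3"]) (use \<open>S2 \<in> set w\<close> in \<open>force simp: col_def nc_coeff_var\<close>)+
    moreover have "nc_coeff (nc.tri (length w) \<phi> (nc_var S1) (nc_var S2 + nc_var S3)) w =
        nc_coeff R (map (the \<circ> col S2 S3) w)"
      by (subst coeff[of _ "col S2 S3"]) (auto simp: col_def nc_coeff_var, metis strand.exhaust)
    moreover have "map (the \<circ> col S2 S3) w = u @ LY # v"
      unfolding w_def by (auto simp: col_def comp_def intro!: map_idI split: letter.split)
    ultimately show ?thesis
      using strand_tri_additive[OF lie pent, of w "length w"] by (auto simp: w_def)
  qed
  have "nc_coeff R w = 0" for w
  proof -
    have split: "\<exists>u v. w = u @ LY # v \<and> LY \<in> set v" if "count_list w LY > 1" for w
    proof -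
      have "LY \<in> set w"
        using that by (metis count_list_0_iff not_less_zero)
      then obtain u v where w: "w = u @ LY # v" "LY \<notin> set u"
        by (meson split_list_first)
      then have "count_list v LY \<noteq> 0"
        using that by auto
      then show ?thesis
        using w(1) by (metis count_notin)
    qed
    \<comment> \<open>A word of length at least three contains \<open>LX\<close> or
      \<open>LY\<close> twice; the former case is moved to the latter by the swap.\<close>
    have "length w = count_list w LX + count_list w LY" "count_list (?swap w) LY = count_list w LX"
    proof (induction w)
      case (Cons x w)
      case 1 show ?case using Cons by (cases x) simp_all
      case 2 show ?case using Cons by (cases x) simp_all
    qed simp_all
    then consider "length w \<le> 2" | "count_list w LY > 1" | "count_list (?swap w) LY > 1"
      by linarith
    then consider "length w \<le> 2" | u v where "w = u @ LY # v" "LY \<in> set v"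
      | u v where "?swap w = u @ LY # v" "LY \<in> set v"
      using split by metis
    then show ?thesis
      by cases (use tri_small two_Y R_swap[of w] in \<open>auto simp: R\<close>)
  qed
  then show ?thesis
    unfolding R_def[symmetric] by (intro ncfps_eqI) simp
qed

theorem theorem3:
  fixes \<phi> :: "(letter, 'k::field_char_0) ncfps"
  assumes "commutator_lie_like \<phi>"
    and "c2 \<phi> = 0"
    and "P5_hat_eq
           (nc_at \<phi> (P5_X 1 2) (P5_X 2 3) + nc_at \<phi> (P5_X 3 4) (P5_X 4 5)
            + nc_at \<phi> (P5_X 5 1) (P5_X 1 2) + nc_at \<phi> (P5_X 2 3) (P5_X 3 4)
            + nc_at \<phi> (P5_X 4 5) (P5_X 5 1)) 0"
  shows "(\<forall>Z. nc_X + nc_Y + Z = 0 \<longrightarrow>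
            nc_at \<phi> nc_X nc_Y + nc_at \<phi> nc_Y Z + nc_at \<phi> Z nc_X = 0)
         \<and> nc_at \<phi> nc_X nc_Y + nc_at \<phi> nc_Y nc_X = 0"
proof -
  have "pentagon \<phi>"
    unfolding pentagon_def by (rule assms(3))
  with assms(1,2) show ?thesis
    by (blast intro: three_cycle two_cycle)
qed

end
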